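(* Let $\omega\approx0.28839$ be the unique real root of $4x^3-3x^2+4x-1$. Then \[\lim_{n\to\infty}\sqrt[n]{W_3(n)}\le\frac{(2-\omega)^{2-\omega}(1+\omega)^{1+\omega}}{\omega^\omega(1-\omega)^{1-\omega}(2\omega)^{2\omega}(1-2\omega)^{1-2\omega}}\approx12.53296.\]
   Context: The stack-sorting map $s$ is defined recursively on permutations (in one-line notation) of distinct positive integers by $s(\emptyset)=\emptyset$ and, if the largest entry of $\pi$ is $n$ and $\pi=LnR$, $s(\pi)=s(L)s(R)n$. A permutation $\pi$ of $[n]$ is $3$-stack sortable if $s^3(\pi)=12\cdots n$, and $W_3(n)$ is the number of $3$-stack sortable permutations of $[n]$. It is known that $\lim_{n\to\infty}\sqrt[n]{W_3(n)}$ exists. *)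

theory Defs
  imports Complex_Main "HOL-Combinatorics.Multiset_Permutations"
begin

lemma takeWhile_shorter: "\<exists>x\<in>set xs. \<not> P x \<Longrightarrow> length (takeWhile P xs) < length xs"
  by (induction xs) auto

function stack_sort :: "nat list \<Rightarrow> nat list" where
  "stack_sort xs =
     (if xs = [] then []
      else (let n = Max (set xs); L = takeWhile (\<lambda>x. x \<noteq> n) xs;
                R = tl (dropWhile (\<lambda>x. x \<noteq> n) xs)
            in stack_sort L @ stack_sort R @ [n]))"
  by pat_completeness auto
termination
proof (relation "measure length")
  fix xs :: "nat list" and n L
  assume "xs \<noteq> []" "n = Max (set xs)" "L = takeWhile (\<lambda>x. x \<noteq> n) xs"
  then show "(L, xs) \<in> measure length"
  proof -
    have "n \<in> set xs" using \<open>xs \<noteq> []\<close> \<open>n = Max (set xs)\<close> by simp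
    then have "\<exists>x\<in>set xs. \<not> (x \<noteq> n)" by blast
    then show ?thesis using \<open>L = _\<close> by (simp add: takeWhile_shorter)
  qed
next
  fix xs :: "nat list" and n L R
  assume "xs \<noteq> []" "n = Max (set xs)" "R = tl (dropWhile (\<lambda>x. x \<noteq> n) xs)"
  then show "(R, xs) \<in> measure length"
    using length_dropWhile_le[of "\<lambda>x. x \<noteq> n" xs] by (cases "dropWhile (\<lambda>x. x \<noteq> n) xs") auto
qed simp

declare stack_sort.simps[simp del]

definition three_stack_sortable :: "nat \<Rightarrow> nat list \<Rightarrow> bool" where
  "three_stack_sortable n p \<longleftrightarrow> (stack_sort ^^ 3) p = [1..<n+1]"

definition W3 :: "nat \<Rightarrow> nat" where
  "W3 n = card {p \<in> permutations_of_set {1..n}. three_stack_sortable n p}"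

end

(*
  W3(n) is the sum, over the 2-stack-sortable p of length n, of the number of stack-sorting preimages
  of p. A preimage is a decreasing binary tree with postorder p, and is determined by the sequence
  telling which nodes have left and right children; the first node and the nodes following a descent
  of p are leaves. Weighting leaves by y and nodes with two children by 1/y bounds the number of
  preimages by K^(n-1) t^(des p), where K = (1+y)^2/y and K t = y.

  It remains to bound the generating function of 2-stack-sortable permutations by length and descents
  at its critical point (z, t). If p = LnR, then s(L)s(R)n avoids 231 iff s(L) and s(R) do, all of L
  except m = max L lies below R, and the entries of s(R) below m precede those above m. So m is
  inserted at a cut of s(R), and the number of components of s(p) serves as catalytic variable. The
  resulting quadratic equation is solved at the critical point, and the solution dominates the
  generating function termwise. The growth rate is then at most K/z, with y = 1 - 2 \<omega>; the cubic
  equation says that K t = y.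
*)
theory Submission
  imports Defs "HOL-Library.Sublist" "HOL-Computational_Algebra.Formal_Power_Series"
begin

section \<open>Stack-sorting and the pattern 231\<close>

lemma stack_sort_Nil [simp]: "stack_sort [] = []"
  by (simp add: stack_sort.simps)

lemma split_at_Max:
  assumes "\<forall>x\<in>set L \<union> set R. x < (n::nat)"
  shows "Max (set (L @ n # R)) = n"
    "takeWhile (\<lambda>x. x \<noteq> n) (L @ n # R) = L"
    "tl (dropWhile (\<lambda>x. x \<noteq> n) (L @ n # R)) = R"
proof -
  show "Max (set (L @ n # R)) = n"
    by (rule Max_eqI) (use assms in \<open>auto intro: less_imp_le\<close>)
  have "\<forall>x\<in>set L. x \<noteq> n" using assms by auto
  then show "takeWhile (\<lambda>x. x \<noteq> n) (L @ n # R) = L"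
    "tl (dropWhile (\<lambda>x. x \<noteq> n) (L @ n # R)) = R"
    by (auto simp: takeWhile_append dropWhile_append)
qed

lemma stack_sort_split:
  assumes "\<forall>x\<in>set L \<union> set R. x < n"
  shows "stack_sort (L @ n # R) = stack_sort L @ stack_sort R @ [n]"
  by (subst stack_sort.simps) (simp add: Let_def split_at_Max[OF assms] del: set_append set_simps)

lemma max_split_exists:
  assumes "distinct xs" "xs \<noteq> []"
  obtains L R where "xs = L @ Max (set xs) # R" "\<forall>x\<in>set L \<union> set R. x < (Max (set xs) :: nat)"
proof -
  have "Max (set xs) \<in> set xs" using assms by simp
  then obtain L R where *: "xs = L @ Max (set xs) # R" by (meson split_list)
  have "x < Max (set xs)" if "x \<in> set L \<union> set R" for x
  proof -
    have "x \<in> set xs" using that by (subst *) auto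
    moreover have "x \<noteq> Max (set xs)"
      using that assms(1) by (subst (asm) *) auto
    ultimately show ?thesis by (simp add: order_less_le)
  qed
  with * show ?thesis using that by blast
qed

text \<open>Turns the recursion at the maximum, shared by \<open>stack_sort\<close> and
  \<open>dtree\<close>, into structural induction. Distinctness makes the maximum occur once, so
  both sides lie strictly below it.\<close>

lemma max_split_induct [consumes 1, case_names Nil split]:
  fixes xs :: "nat list"
  assumes "distinct xs"
    and "P []"
    and "\<And>L n R. \<lbrakk>distinct (L @ n # R); \<forall>x\<in>set L \<union> set R. x < n; P L; P R\<rbrakk> \<Longrightarrow> P (L @ n # R)"
  shows "P xs"
  using assms(1)
proof (induction xs rule: length_induct)
  case (1 xs)
  show ?case
  proof (cases "xs = []")
    case False
    obtain L R where LR: "xs = L @ Max (set xs) # R" "\<forall>x\<in>set L \<union> set R. x < Max (set xs)"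
      using max_split_exists[OF "1.prems" False] by blast
    have d: "distinct (L @ Max (set xs) # R)" using "1.prems" LR(1) by simp
    have "length xs = length (L @ Max (set xs) # R)" using LR(1) by (rule arg_cong)
    then have "length L < length xs" "length R < length xs" by auto
    then have "P L" "P R" using d "1.IH" by auto
    then show ?thesis using assms(3)[OF d LR(2)] LR(1) by simp
  qed (use assms(2) in simp)
qed

lemma mset_stack_sort:
  assumes "distinct xs"
  shows "mset (stack_sort xs) = mset xs"
  using assms by (induction rule: max_split_induct) (simp_all add: stack_sort_split)

lemma stack_sort_distinct_simps:
  assumes "distinct xs"
  shows "set (stack_sort xs) = set xs" "length (stack_sort xs) = length xs"
    "distinct (stack_sort xs)"
  using mset_stack_sort[OF assms] assms
  by (metis mset_eq_setD, metis mset_eq_length, metis mset_eq_imp_distinct_iff)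

definition av231 :: "nat list \<Rightarrow> bool" where
  "av231 xs \<longleftrightarrow> (\<forall>a b c. subseq [b, c, a] xs \<longrightarrow> \<not> (a < b \<and> b < c))"

lemma av231D: "av231 xs \<Longrightarrow> subseq [b, c, a] xs \<Longrightarrow> a < b \<Longrightarrow> b < c \<Longrightarrow> False"
  unfolding av231_def by blast

lemma av231_subseq: "av231 ys \<Longrightarrow> subseq xs ys \<Longrightarrow> av231 xs"
  unfolding av231_def by (meson subseq_order.trans)

lemma subseq_append_split:
  assumes "subseq zs (xs @ ys)"
  obtains us vs where "zs = us @ vs" "subseq us xs" "subseq vs ys"
  using assms by (meson list_emb_appendD subseq_append_iff)

lemma subseq_set: "subseq xs ys \<Longrightarrow> set xs \<subseteq> set ys"
  by (induction rule: list_emb.induct) auto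

text \<open>One direction of Knuth's criterion. Since \<open>a\<close> and \<open>b\<close> are
  below \<open>n\<close>, an occurrence of the pattern yields one inside \<open>L\<close> or inside
  \<open>R\<close>, or has \<open>b\<close> in \<open>L\<close> and \<open>a\<close> in
  \<open>R\<close>. In the last case \<open>b\<close> is output before \<open>a\<close>, so
  sortedness gives \<open>b \<le> a\<close>.\<close>

lemma sorted_stack_sort_imp_av231:
  assumes "distinct xs" "sorted (stack_sort xs)"
  shows "av231 xs"
  using assms
proof (induction rule: max_split_induct)
  case Nil
  then show ?case by (simp add: av231_def)
next
  case (split L n R)
  have s: "sorted (stack_sort L @ stack_sort R @ [n])"
    using split by (simp add: stack_sort_split)
  have dL: "distinct L" and dR: "distinct R" using split by auto
  have "sorted (stack_sort L)" "sorted (stack_sort R)"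
    using s unfolding sorted_append by blast+
  then have av: "av231 L" "av231 R" using split.IH by blast+
  have LR: "x \<le> y" if "x \<in> set L" "y \<in> set R" for x y
  proof -
    have "\<forall>x\<in>set (stack_sort L). \<forall>y\<in>set (stack_sort R @ [n]). x \<le> y"
      using s unfolding sorted_append by blast
    then show ?thesis using that by (simp add: stack_sort_distinct_simps(1) dL dR)
  qed
  show ?case
    unfolding av231_def
  proof (intro allI impI notI)
    fix a b c
    assume sub: "subseq [b, c, a] (L @ n # R)" and lt: "a < b \<and> b < c"
    have "c \<in> set (L @ n # R)" using subseq_set[OF sub] by simp
    then have "c \<le> n" using split(2) by (auto intro: less_imp_le)
    then have "a < n" "b < n" using lt by simp_all
    obtain us vs where uv: "[b, c, a] = us @ vs" "subseq us L" "subseq vs (n # R)"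
      using sub by (rule subseq_append_split)
    consider "us = []" "vs = [b, c, a]" | "us \<noteq> []" "vs = []" "us = [b,c,a]" | "us \<noteq> []" "vs \<noteq> []"
      using uv(1) by fastforce
    then show False
    proof cases
      case 1
      then have "subseq [b, c, a] R" using uv(3) \<open>b < n\<close> by auto
      then show False using av(2) lt av231D by blast
    next
      case 2
      then show False using uv(2) av(1) lt av231D by blast
    next
      case 3
      have "b = hd us" "a = last vs" using 3 uv(1)
        by (metis hd_append2 list.sel(1), metis last_appendR last.simps list.distinct(1))
      then have "b \<in> set L" "a \<in> set (n # R)"
        using 3 subseq_set[OF uv(2)] subseq_set[OF uv(3)] by fastforce+
      then show False using LR lt \<open>a < n\<close> by fastforce
    qed
  qed
qed

section \<open>Decreasing trees labelled by insertion cuts\<close>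

datatype cut_tree = Leaf | Node cut_tree nat cut_tree

text \<open>\<open>Node l j r\<close> stands for \<open>L @ n # R\<close> where \<open>j\<close> entries of \<open>R\<close> are below \<open>Max (set L)\<close>.\<close>
function dtree :: "nat list \<Rightarrow> cut_tree" where
  "dtree xs =
     (if xs = [] then Leaf
      else (let n = Max (set xs); L = takeWhile (\<lambda>x. x \<noteq> n) xs;
                R = tl (dropWhile (\<lambda>x. x \<noteq> n) xs)
            in Node (dtree L) (if L = [] then 0 else card {x \<in> set R. x < Max (set L)}) (dtree R)))"
  by pat_completeness auto
termination
proof (relation "measure length")
  fix xs n L
  assume "xs \<noteq> []" "n = Max (set xs)" "L = takeWhile (\<lambda>x. x \<noteq> n) xs"
  then show "(L, xs) \<in> measure length"
    using takeWhile_shorter[of xs "\<lambda>x. x \<noteq> n"] Max_in[of "set xs"] by auto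
next
  fix xs n R
  assume "xs \<noteq> []" "R = tl (dropWhile (\<lambda>x. x \<noteq> n) xs)"
  then show "(R, xs) \<in> measure length"
    using length_dropWhile_le[of "\<lambda>x. x \<noteq> n" xs] by (cases "dropWhile (\<lambda>x. x \<noteq> n) xs") auto
qed simp

declare dtree.simps [simp del]

lemma dtree_Nil [simp]: "dtree [] = Leaf"
  by (simp add: dtree.simps)

lemma dtree_split:
  assumes "\<forall>x\<in>set L \<union> set R. x < n"
  shows "dtree (L @ n # R) =
    Node (dtree L) (if L = [] then 0 else card {x \<in> set R. x < Max (set L)}) (dtree R)"
  by (subst dtree.simps) (simp add: Let_def split_at_Max[OF assms] del: set_append set_simps)

primrec tsize :: "cut_tree \<Rightarrow> nat" where
  "tsize Leaf = 0"
| "tsize (Node l j r) = Suc (tsize l + tsize r)"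

primrec tdes :: "cut_tree \<Rightarrow> nat" where
  "tdes Leaf = 0"
| "tdes (Node l j r) = tdes l + tdes r + of_bool (r \<noteq> Leaf)"

text \<open>The positions at which \<open>stack_sort xs\<close> may split into a low part followed by a high part,
  read off from \<open>dtree xs\<close>.\<close>
primrec cuts :: "cut_tree \<Rightarrow> nat set" where
  "cuts Leaf = {0}"
| "cuts (Node l j r) =
     {k \<in> cuts l. k < tsize l} \<union> (+) (tsize l) ` {k \<in> cuts r. j \<le> k} \<union> {Suc (tsize l + tsize r)}"

text \<open>The index bounds the height, which keeps the sets finite. With an empty left part there
  is no maximum to insert, and the default label 0 prevents several copies of the same tree.\<close>

primrec trees :: "nat \<Rightarrow> cut_tree set" where
  "trees 0 = {Leaf}"
| "trees (Suc h) = insert Leaf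
     {Node l j r | l j r. l \<in> trees h \<and> r \<in> trees h \<and> j \<in> cuts r \<and> (l = Leaf \<longrightarrow> j = 0)}"

lemma tsize_dtree: "distinct xs \<Longrightarrow> tsize (dtree xs) = length xs"
  by (induction rule: max_split_induct) (simp_all add: dtree_split)

lemma trees_mono: "h \<le> h' \<Longrightarrow> trees h \<subseteq> trees h'"
proof -
  have "trees h \<subseteq> trees (Suc h)" for h
    by (induction h) auto
  then show "h \<le> h' \<Longrightarrow> trees h \<subseteq> trees h'" by (rule lift_Suc_mono_le)
qed

lemma cuts_le_tsize: "k \<in> cuts T \<Longrightarrow> k \<le> tsize T"
  by (induction T arbitrary: k) fastforce+

lemma finite_cuts: "finite (cuts T)"
  by (rule finite_subset[of _ "{..tsize T}"]) (auto dest: cuts_le_tsize)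

lemma finite_trees: "finite (trees h)"
proof (induction h)
  case (Suc h)
  have "trees (Suc h) \<subseteq> insert Leaf
     ((\<lambda>(l, r, j). Node l j r) ` (trees h \<times> (SIGMA r:trees h. cuts r)))"
    by force
  then show ?case by (rule finite_subset) (auto intro: finite_cuts Suc)
qed simp

text \<open>Both ends of the list count, so a permutation has one cut more than it has components in
  its direct-sum decomposition.\<close>

definition cutpos :: "nat list \<Rightarrow> nat set" where
  "cutpos xs = {k. k \<le> length xs \<and> (\<forall>x\<in>set (take k xs). \<forall>y\<in>set (drop k xs). x < y)}"

lemma filter_append_filter:
  assumes "\<And>c a. subseq [c, a] xs \<Longrightarrow> P a \<Longrightarrow> P c"
  shows "xs = filter P xs @ filter (\<lambda>x. \<not> P x) xs"
  using assms
proof (induction xs)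
  case (Cons x xs)
  have IH: "xs = filter P xs @ filter (\<lambda>x. \<not> P x) xs"
    by (rule Cons.IH) (use Cons.prems in \<open>meson list_emb_Cons\<close>)
  show ?case
  proof (cases "P x")
    case False
    have "\<not> P a" if "a \<in> set xs" for a
      using Cons.prems[of x a] that False by (auto simp: subseq_singleton_left)
    then show ?thesis using False by (auto intro: sym[OF filter_True])
  qed (use IH in simp)
qed simp

lemma stack_sort_last:
  assumes "distinct L" "L \<noteq> []"
  obtains L' where "stack_sort L = L' @ [Max (set L)]" "set L' = set L - {Max (set L)}"
proof -
  obtain A B where AB: "L = A @ Max (set L) # B" "\<forall>x\<in>set A \<union> set B. x < Max (set L)"
    using max_split_exists[OF assms] by blast
  have *: "stack_sort L = (stack_sort A @ stack_sort B) @ [Max (set L)]"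
    using stack_sort_split[OF AB(2)] AB(1) by simp
  have "distinct (stack_sort L)" "set (stack_sort L) = set L"
    by (rule stack_sort_distinct_simps[OF assms(1)])+
  then have "set (stack_sort A @ stack_sort B) = set L - {Max (set L)}"
    using * by (metis Diff_insert_absorb Un_insert_right distinct_append disjoint_iff list.set_intros(1)
       set_append sup_bot.right_neutral list.set(1) list.set(2))
  with * that show ?thesis by blast
qed

text \<open>Let m = \<open>Max (set L)\<close>, the last entry of \<open>stack_sort L\<close>. A
  failure of the third conclusion produces the pattern 231 at a, m, r with m as its largest letter;
  a failure of the fourth produces it at m, c, a with m as its middle letter.\<close>

lemma av231_stack_sort_split:
  assumes d: "distinct (L @ n # R)" and n: "\<forall>x\<in>set L \<union> set R. x < n"
    and av: "av231 (stack_sort (L @ n # R))"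
  shows "av231 (stack_sort L)" "av231 (stack_sort R)"
    and "\<lbrakk>L \<noteq> []; a \<in> set L; a \<noteq> Max (set L); r \<in> set R\<rbrakk> \<Longrightarrow> a < r"
    and "\<lbrakk>L \<noteq> []; subseq [c, a] (stack_sort R); a < Max (set L)\<rbrakk> \<Longrightarrow> c < Max (set L)"
proof -
  have s: "stack_sort (L @ n # R) = stack_sort L @ stack_sort R @ [n]"
    by (rule stack_sort_split[OF n])
  show "av231 (stack_sort L)" "av231 (stack_sort R)"
    by (rule av231_subseq[OF av], unfold s, blast intro: list_emb_append2 list_emb_prefix)+
  have dL: "distinct L" and dR: "distinct R" using d by auto
  show "a < r" if L: "L \<noteq> []" "a \<in> set L" "a \<noteq> Max (set L)" "r \<in> set R" for a r
  proof (rule ccontr)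
    assume "\<not> a < r"
    moreover have "a \<noteq> r" using d that by auto
    ultimately have "r < a" by simp
    obtain L' where L': "stack_sort L = L' @ [Max (set L)]" "set L' = set L - {Max (set L)}"
      using stack_sort_last[OF dL L(1)] by blast
    have "subseq ([a] @ [Max (set L)] @ [r] @ []) (L' @ [Max (set L)] @ stack_sort R @ [n])"
      by (intro list_emb_append_mono)
        (use L L' in \<open>auto simp: subseq_singleton_left stack_sort_distinct_simps[OF dR]\<close>)
    then have "subseq [a, Max (set L), r] (stack_sort (L @ n # R))" by (simp add: s L')
    moreover have "a < Max (set L)" using L by (simp add: order_less_le)
    ultimately show False using av231D[OF av] \<open>r < a\<close> by blast
  qed
  show "c < Max (set L)"
    if L: "L \<noteq> []" "subseq [c, a] (stack_sort R)" "a < Max (set L)" for c a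
  proof (rule ccontr)
    assume "\<not> c < Max (set L)"
    moreover have "c \<in> set R" using subseq_set[OF L(2)] by (simp add: stack_sort_distinct_simps[OF dR])
    moreover have M: "Max (set L) \<in> set L" using L by simp
    ultimately have "Max (set L) < c" using d by (metis Int_iff disjoint_iff distinct_append linorder_neqE_nat list.set_intros(2))
    have "subseq ([Max (set L)] @ [c, a] @ []) (stack_sort L @ stack_sort R @ [n])"
      by (intro list_emb_append_mono)
        (use L M in \<open>auto simp: subseq_singleton_left stack_sort_distinct_simps[OF dL]\<close>)
    then have "subseq [Max (set L), c, a] (stack_sort (L @ n # R))" by (simp add: s)
    then show False using av231D[OF av] \<open>Max (set L) < c\<close> L(3) by blast
  qed
qed

text \<open>No entry that is at least \<open>m\<close> precedes one below \<open>m\<close>, so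
  filtering splits the sorted list into a low block followed by a high block.\<close>

lemma cutpos_card_less:
  assumes "distinct R" "\<And>c a. subseq [c, a] (stack_sort R) \<Longrightarrow> a < m \<Longrightarrow> c < m" "m \<notin> set R"
  shows "card {x \<in> set R. x < m} \<in> cutpos (stack_sort R)"
proof -
  let ?r = "stack_sort R"
  have r: "?r = filter (\<lambda>x. x < m) ?r @ filter (\<lambda>x. \<not> x < m) ?r"
    by (rule filter_append_filter) (use assms(2) in blast)
  have "{x \<in> set R. x < m} = set (filter (\<lambda>x. x < m) ?r)"
    by (simp add: stack_sort_distinct_simps[OF assms(1)])
  moreover have "distinct (filter (\<lambda>x. x < m) ?r)"
    by (simp add: stack_sort_distinct_simps[OF assms(1)])
  ultimately have c: "card {x \<in> set R. x < m} = length (filter (\<lambda>x. x < m) ?r)"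
    by (metis distinct_card)
  have "take (length (filter (\<lambda>x. x < m) ?r)) ?r = filter (\<lambda>x. x < m) ?r"
    "drop (length (filter (\<lambda>x. x < m) ?r)) ?r = filter (\<lambda>x. \<not> x < m) ?r"
    by (subst (2) r, simp)+
  then show ?thesis unfolding cutpos_def c
    by auto
qed

text \<open>A cut after all of \<open>stack_sort L\<close> puts the maximum of \<open>L\<close> into
  the low part, which must then contain every entry of \<open>R\<close> below that maximum; this is
  the bound on \<open>k'\<close>. A cut at exactly \<open>length L\<close> is of this kind, hence
  the strict inequality in the first case.\<close>

lemma cutpos_split:
  assumes d: "distinct (L @ n # R)" and n: "\<forall>x\<in>set L \<union> set R. x < n"
    and k: "k \<in> cutpos (stack_sort (L @ n # R))"
  shows "k < length L \<and> k \<in> cutpos (stack_sort L) \<or>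
    (\<exists>k'. k = length L + k' \<and> k' \<in> cutpos (stack_sort R) \<and>
       (L \<noteq> [] \<longrightarrow> card {x \<in> set R. x < Max (set L)} \<le> k')) \<or>
    k = Suc (length L + length R)"
proof -
  have s: "stack_sort (L @ n # R) = stack_sort L @ stack_sort R @ [n]"
    by (rule stack_sort_split[OF n])
  have dL: "distinct L" and dR: "distinct R" using d by auto
  note len = stack_sort_distinct_simps[OF dL] stack_sort_distinct_simps[OF dR]
  have k1: "k \<le> Suc (length L + length R)"
    and k2: "\<And>x y. x \<in> set (take k (stack_sort L @ stack_sort R @ [n])) \<Longrightarrow>
       y \<in> set (drop k (stack_sort L @ stack_sort R @ [n])) \<Longrightarrow> x < y"
    using k unfolding cutpos_def by (auto simp: s len)
  consider "k < length L" | "length L \<le> k" "k \<le> length L + length R" | "k = Suc (length L + length R)"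
    using k1 by linarith
  then show ?thesis
  proof cases
    case 1
    then have "k \<in> cutpos (stack_sort L)"
      using k2 by (auto simp: cutpos_def len)
    with 1 show ?thesis by blast
  next
    case 2
    define k' where "k' = k - length L"
    have kk: "k = length L + k'" "k' \<le> length R" using 2 by (auto simp: k'_def)
    have k3: "x < y" if "x \<in> set L \<union> set (take k' (stack_sort R))" "y \<in> set (drop k' (stack_sort R))" for x y
      by (rule k2) (use that kk len in auto)
    have "k' \<in> cutpos (stack_sort R)" using k3 kk by (auto simp: cutpos_def len)
    moreover have "card {x \<in> set R. x < Max (set L)} \<le> k'" if "L \<noteq> []"
    proof -
      have "{x \<in> set R. x < Max (set L)} \<subseteq> set (take k' (stack_sort R))"
      proof
        fix x assume x: "x \<in> {x \<in> set R. x < Max (set L)}"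
        then have "x \<in> set (take k' (stack_sort R)) \<union> set (drop k' (stack_sort R))"
          by (simp only: set_append[symmetric] append_take_drop_id len) auto
        moreover have "x \<notin> set (drop k' (stack_sort R))"
          using k3[of "Max (set L)" x] x Max_in[of "set L"] that by (auto simp del: Max_less_iff)
        ultimately show "x \<in> set (take k' (stack_sort R))" by blast
      qed
      then have "card {x \<in> set R. x < Max (set L)} \<le> card (set (take k' (stack_sort R)))"
        by (rule card_mono[rotated]) simp
      also have "\<dots> \<le> k'" by (rule order.trans[OF card_length]) simp
      finally show ?thesis .
    qed
    ultimately show ?thesis using kk by blast
  qed blast
qed

text \<open>The claims are proved together because the first uses the second: the root label is a
  cut of \<open>stack_sort R\<close>, and the inclusion for \<open>R\<close> makes it an element of
  \<open>cuts (dtree R)\<close>.\<close>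

lemma dtree_trees:
  assumes "distinct xs" "av231 (stack_sort xs)"
  shows "dtree xs \<in> trees (length xs) \<and> cutpos (stack_sort xs) \<subseteq> cuts (dtree xs)"
  using assms
proof (induction rule: max_split_induct)
  case Nil
  then show ?case by (auto simp: cutpos_def)
next
  case (split L n R)
  note av = av231_stack_sort_split[OF split(1,2) split.prems]
  have dL: "distinct L" and dR: "distinct R" using split by auto
  have IH: "dtree L \<in> trees (length L)" "cutpos (stack_sort L) \<subseteq> cuts (dtree L)"
    "dtree R \<in> trees (length R)" "cutpos (stack_sort R) \<subseteq> cuts (dtree R)"
    using split.IH av(1,2) by auto
  let ?j = "if L = [] then 0 else card {x \<in> set R. x < Max (set L)}"
  have "?j \<in> cuts (dtree R)"
  proof (cases "L = []")
    case True
    have "0 \<in> cutpos (stack_sort R)" by (simp add: cutpos_def)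
    then show ?thesis using True IH by auto
  next
    case False
    have notin: "Max (set L) \<notin> set R" using split(1) False by (metis Max_in List.finite_set disjoint_iff
       distinct_append list.set_intros(2) set_empty)
    have "card {x \<in> set R. x < Max (set L)} \<in> cutpos (stack_sort R)"
      by (rule cutpos_card_less[OF dR _ notin]) (rule av(4)[OF False])
    then show ?thesis using False IH(4) by (simp only: if_False subset_iff)
  qed
  moreover have "dtree L \<in> trees (length L + length R)" "dtree R \<in> trees (length L + length R)"
    using IH trees_mono[of "length L" "length L + length R"] trees_mono[of "length R" "length L + length R"] by auto
  moreover have "dtree L = Leaf \<longrightarrow> L = []" using tsize_dtree[OF dL] by auto
  ultimately have 1: "dtree (L @ n # R) \<in> trees (length (L @ n # R))"
    by (auto simp: dtree_split[OF split(2)])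
  have "cutpos (stack_sort (L @ n # R)) \<subseteq> cuts (dtree (L @ n # R))"
    using cutpos_split[OF split(1,2)] IH(2,4)
    by (fastforce simp: dtree_split[OF split(2)] tsize_dtree dL dR)
  with 1 show ?case by blast
qed

section \<open>Injectivity of the tree encoding\<close>

lemma initial_segment_unique:
  fixes A B A' B' :: "nat set"
  assumes "finite (A \<union> B)" "A \<union> B = A' \<union> B'" "\<forall>a\<in>A. \<forall>b\<in>B. a < b" "\<forall>a\<in>A'. \<forall>b\<in>B'. a < b"
    "card A = card A'"
  shows "A = A'"
proof (rule ccontr)
  assume "A \<noteq> A'"
  have f: "finite A" "finite A'" using assms(1,2) by (auto intro: finite_subset)
  consider x where "x \<in> A" "x \<notin> A'" | x where "x \<in> A'" "x \<notin> A" using \<open>A \<noteq> A'\<close> by blast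
  then show False
  proof cases
    case 1
    have "x \<in> B'" using 1 assms(2) by blast
    then have "A' \<subseteq> A" using 1 assms(2-4) by (metis UnE UnI1 less_asym subsetI)
    then show False using f assms(5) 1 by (metis card_subset_eq)
  next
    case 2
    have "x \<in> B" using 2 assms(2) by blast
    then have "A \<subseteq> A'" using 2 assms(2-4) by (metis UnE UnI1 less_asym subsetI)
    then show False using f assms(5) 2 by (metis card_subset_eq)
  qed
qed

lemma rank_unique:
  fixes m m' :: nat
  assumes "finite Q" "m \<in> Q" "m' \<in> Q" "card {x\<in>Q. x < m} = card {x\<in>Q. x < m'}"
  shows "m = m'"
proof -
  have "card {x\<in>Q. x < a} < card {x\<in>Q. x < b}" if "a \<in> Q" "a < b" for a b
  proof (rule psubset_card_mono)
    show "{x\<in>Q. x < a} \<subset> {x\<in>Q. x < b}" using that by auto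
  qed (use assms(1) in simp)
  from this[of m m'] this[of m' m] show ?thesis
    using assms(2-4) by (cases m m' rule: linorder_cases) simp_all
qed

text \<open>The subtree sizes and the root label determine which values go left: \<open>L\<close>
  without its maximum m is an initial segment, of known size, of the values below \<open>n\<close>,
  and the label is the rank of m among the remaining values. Then the induction hypothesis applies
  to both sides.\<close>

lemma dtree_inj:
  assumes "distinct xs" "av231 (stack_sort xs)" "distinct ys" "av231 (stack_sort ys)"
    "set xs = set ys" "dtree xs = dtree ys"
  shows "xs = ys"
  using assms
proof (induction arbitrary: ys rule: max_split_induct)
  case Nil
  then show ?case by simp
next
  case (split L n R ys)
  have "ys \<noteq> []" using split.prems by auto
  have "Max (set ys) = n" using split_at_Max(1)[OF split(2)] split.prems by simp
  then obtain L' R' where ys: "ys = L' @ n # R'" and n': "\<forall>x\<in>set L' \<union> set R'. x < n"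
    using max_split_exists[OF split.prems(2) \<open>ys \<noteq> []\<close>] by metis
  have d': "distinct (L' @ n # R')" using split.prems ys by simp
  have D: "distinct L" "distinct R" "distinct L'" "distinct R'" using split(1) d' by auto
  note av = av231_stack_sort_split[OF split(1,2) split.prems(1)]
  note av' = av231_stack_sort_split[OF d' n' split.prems(3)[unfolded ys]]
  have T: "dtree L = dtree L'" "dtree R = dtree R'"
    and j: "(if L = [] then 0 else card {x \<in> set R. x < Max (set L)}) =
     (if L' = [] then 0 else card {x \<in> set R'. x < Max (set L')})"
    using split.prems(5) unfolding ys dtree_split[OF split(2)] dtree_split[OF n'] by auto
  have len: "length L = length L'" "length R = length R'"
    using T by (metis D tsize_dtree)+
  have S: "set L \<union> set R = set L' \<union> set R'"
    using split.prems(4) split(2) n' unfolding ys by auto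
  have "set L = set L' \<and> set R = set R'"
  proof (cases "L = []")
    case True
    then show ?thesis using len S by auto
  next
    case False
    then have False': "L' \<noteq> []" using len by auto
    let ?m = "Max (set L)" and ?m' = "Max (set L')"
    have m: "?m \<in> set L" "?m' \<in> set L'" using False False' by auto
    have c: "card (set L) = card (set L')" using D len by (simp add: distinct_card)
    have 1: "set L - {?m} = set L' - {?m'}"
    proof (rule initial_segment_unique)
      show "finite ((set L - {?m}) \<union> ({?m} \<union> set R))" by simp
      show "(set L - {?m}) \<union> ({?m} \<union> set R) = (set L' - {?m'}) \<union> ({?m'} \<union> set R')"
        using m S by blast
      show "\<forall>a\<in>set L - {?m}. \<forall>b\<in>{?m} \<union> set R. a < b"
        using av(3)[OF False] by (auto simp: order_less_le)
      show "\<forall>a\<in>set L' - {?m'}. \<forall>b\<in>{?m'} \<union> set R'. a < b"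
        using av'(3)[OF False'] by (auto simp: order_less_le)
      show "card (set L - {?m}) = card (set L' - {?m'})" using m c by simp
    qed
    have disj: "set L \<inter> set R = {}" "set L' \<inter> set R' = {}" using split(1) d' by auto
    have 2: "insert ?m (set R) = insert ?m' (set R')" using 1 S m disj by blast
    \<comment> \<open>\<open>?m\<close> is not below itself, so both labels are ranks in the set
      from the previous step, which is common to the two lists.\<close>
    have "{x \<in> set R. x < ?m} = {x \<in> insert ?m (set R). x < ?m}"
      "{x \<in> set R'. x < ?m'} = {x \<in> insert ?m' (set R'). x < ?m'}"
      by blast+
    note this(1) this(2)[folded 2]
    then have c': "card {x \<in> insert ?m (set R). x < ?m} = card {x \<in> insert ?m (set R). x < ?m'}"
      using j False False' by metis
    have "?m' \<in> insert ?m (set R)" unfolding 2 by (rule insertI1)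
    then have mm: "?m = ?m'" using c' by (rule rank_unique[OF finite.insertI[OF List.finite_set] insertI1])
    have "set L = set L'" using 1 m unfolding mm by blast
    then show ?thesis using S disj by blast
  qed
  then have "L = L'" "R = R'"
    using split.IH(1)[OF av(1) D(3) av'(1)] split.IH(2)[OF av(2) D(4) av'(2)] T by blast+
  then show ?case using ys by simp
qed

section \<open>Preimages under stack-sorting\<close>

text \<open>Nodes are listed in postorder because \<open>stack_sort\<close> outputs the labels of
  the decreasing tree in that order.\<close>

primrec word :: "cut_tree \<Rightarrow> (bool \<times> bool) list" where
  "word Leaf = []"
| "word (Node l j r) = word l @ word r @ [(l \<noteq> Leaf, r \<noteq> Leaf)]"

text \<open>The stack holds the completed subtrees, each as its inorder reading. The right child was
  completed last, so it is popped first.\<close>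

fun decode :: "(bool \<times> bool) list \<Rightarrow> nat list \<Rightarrow> nat list list \<Rightarrow> nat list list" where
  "decode ((l, r) # w) (n # p) st =
     (let R = (if r then hd st else []); st' = (if r then tl st else st);
          L = (if l then hd st' else []); st'' = (if l then tl st' else st')
      in decode w p ((L @ n # R) # st''))"
| "decode w p st = st"

lemma dtree_eq_Leaf_iff: "distinct xs \<Longrightarrow> dtree xs = Leaf \<longleftrightarrow> xs = []"
  using tsize_dtree[of xs] by auto

lemma decode_word:
  assumes "distinct xs"
  shows "decode (word (dtree xs) @ w) (stack_sort xs @ p) st =
    decode w p (if xs = [] then st else xs # st)"
  using assms
proof (induction arbitrary: w p st rule: max_split_induct)
  case (split L n R)
  have "distinct L" "distinct R" using split by auto
  then show ?case
    by (simp add: dtree_split[OF split(2)] stack_sort_split[OF split(2)] split.IH dtree_eq_Leaf_iff Let_def)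
qed simp

lemma word_dtree_inj:
  assumes "distinct xs" "distinct ys" "stack_sort xs = stack_sort ys" "word (dtree xs) = word (dtree ys)"
    "xs \<noteq> []" "ys \<noteq> []"
  shows "xs = ys"
  using decode_word[OF assms(1), of "[]" "[]" "[]"] decode_word[OF assms(2), of "[]" "[]" "[]"] assms(3-6)
  by simp

section \<open>Descents and their effect on the words\<close>

fun des :: "nat list \<Rightarrow> nat" where
  "des (x # y # ys) = of_bool (y < x) + des (y # ys)"
| "des _ = 0"

lemma des_split:
  assumes "\<forall>x\<in>set L \<union> set R. x < n"
  shows "des (L @ n # R) = des L + des R + of_bool (R \<noteq> [])"
proof -
  have "des (n # R) = des R + of_bool (R \<noteq> [])"
    using assms by (cases R) auto
  then show ?thesis using assms by (induction L rule: des.induct) auto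
qed

lemma tdes_dtree: "distinct xs \<Longrightarrow> tdes (dtree xs) = des xs"
proof (induction rule: max_split_induct)
  case (split L n R)
  have "distinct R" using split by auto
  then show ?case using split
    by (simp add: dtree_split[OF split(2)] des_split[OF split(2)] dtree_eq_Leaf_iff)
qed simp

text \<open>The node in postorder position \<open>i + 1\<close> is not the parent of the one in position \<open>i\<close> if the
  labels descend there, so it starts a new right subtree and is childless.\<close>
primrec slots :: "nat \<Rightarrow> nat list \<Rightarrow> (bool \<times> bool) set list" where
  "slots a [] = []"
| "slots a (x # xs) = (if x < a then {(False, False)} else UNIV) # slots x xs"

lemma slots_append: "slots a (xs @ ys) = slots a xs @ slots (last (a # xs)) ys"
  by (induction xs arbitrary: a) auto

lemma listset_append: "u \<in> listset As \<Longrightarrow> v \<in> listset Bs \<Longrightarrow> u @ v \<in> listset (As @ Bs)"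
  by (induction As arbitrary: u) (auto simp: set_Cons_def)

text \<open>If the root has a child, the label before it in postorder comes from \<open>L\<close> or
  \<open>R\<close> and is below \<open>n\<close>, so its slot is unrestricted; a childless node fits
  every slot. \<open>a\<close> may be arbitrary because the first node in postorder is a
  leaf.\<close>

lemma word_in_slots:
  assumes "distinct xs"
  shows "word (dtree xs) \<in> listset (slots a (stack_sort xs))"
  using assms
proof (induction arbitrary: a rule: max_split_induct)
  case (split L n R)
  have d: "distinct L" "distinct R" using split by auto
  define b where "b = last (last (a # stack_sort L) # stack_sort R)"
  have b: "b < n" if "L \<noteq> [] \<or> R \<noteq> []"
  proof -
    have "length (stack_sort L @ stack_sort R) \<noteq> 0"
      using that by (simp add: stack_sort_distinct_simps d)
    then have "b \<in> set (stack_sort L @ stack_sort R)"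
      by (cases "stack_sort R = []") (auto simp: b_def)
    then show ?thesis using split(2) by (simp add: stack_sort_distinct_simps d)
  qed
  have "[(L \<noteq> [], R \<noteq> [])] \<in> listset (slots b [n])"
    by (cases "n < b") (use b in \<open>force simp: set_Cons_def\<close>)+
  then have "(word (dtree L) @ word (dtree R)) @ [(L \<noteq> [], R \<noteq> [])]
      \<in> listset ((slots a (stack_sort L) @ slots (last (a # stack_sort L)) (stack_sort R)) @ slots b [n])"
    by (intro listset_append split.IH)
  then show ?case
    by (simp add: b_def dtree_split[OF split(2)] stack_sort_split[OF split(2)] dtree_eq_Leaf_iff d slots_append
          del: slots.simps listset.simps last.simps)
qed simp

lemma finite_listset: "(\<And>A. A \<in> set As \<Longrightarrow> finite A) \<Longrightarrow> finite (listset As)"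
proof (induction As)
  case (Cons A As)
  have "listset (A # As) = (\<lambda>(a, w). a # w) ` (A \<times> listset As)"
    by (auto simp: set_Cons_def)
  then show ?case using Cons by auto
qed simp

lemma sum_prod_listset:
  fixes f :: "'a \<Rightarrow> real"
  shows "(\<Sum>w\<in>listset As. prod_list (map f w)) = prod_list (map (sum f) As)"
proof (induction As)
  case (Cons A As)
  have *: "listset (A # As) = (\<lambda>(a, w). a # w) ` (A \<times> listset As)"
    by (auto simp: set_Cons_def)
  have "inj_on (\<lambda>(a, w). a # w) (A \<times> listset As)" by (auto simp: inj_on_def)
  then have "(\<Sum>w\<in>listset (A # As). prod_list (map f w)) = (\<Sum>(a, w)\<in>A \<times> listset As. f a * prod_list (map f w))"
    unfolding * by (subst sum.reindex) (auto simp: case_prod_beta intro!: sum.cong)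
  also have "\<dots> = sum f A * (\<Sum>w\<in>listset As. prod_list (map f w))"
    by (simp add: sum_product sum.cartesian_product)
  finally show ?case by (simp add: Cons.IH)
qed simp

text \<open>The exponent of \<open>y\<close> is the increment of the stack size in \<open>decode\<close>.\<close>
fun wt :: "real \<Rightarrow> bool \<times> bool \<Rightarrow> real" where
  "wt y (False, False) = y"
| "wt y (True, True) = 1 / y"
| "wt y _ = 1"

lemma sum_wt: "y \<noteq> 0 \<Longrightarrow> sum (wt y) UNIV = (1 + y)\<^sup>2 / y"
  by (simp add: UNIV_bool flip: UNIV_Times_UNIV) (simp add: field_simps power2_eq_square)

text \<open>The exponent at a node is 1 minus its number of children. A tree with m > 0 nodes has m
  - 1 edges, so the exponents add up to 1.\<close>

lemma prod_wt_word: "y \<noteq> 0 \<Longrightarrow> prod_list (map (wt y) (word T)) = (if T = Leaf then 1 else y)"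
  by (induction T) auto

text \<open>A free slot contributes \<open>K\<close> and a slot at a descent contributes
  \<open>y\<close>, which is \<open>K * t\<close>; so every slot yields \<open>K\<close> and every
  descent an extra \<open>t\<close>.\<close>

lemma prod_slots:
  fixes K t y :: real
  assumes "y \<noteq> 0" and K: "K = (1 + y)\<^sup>2 / y" and t: "K * t = y"
  shows "prod_list (map (sum (wt y)) (slots a xs)) = K ^ length xs * t ^ des (a # xs)"
proof (induction xs arbitrary: a)
  case (Cons x xs)
  show ?case
    using t sum_wt[OF assms(1)] by (simp add: Cons.IH K[symmetric])
qed simp

text \<open>The words of all preimages have the same weight \<open>y\<close>, and the total weight
  of the admissible words factors over the slots.\<close>

lemma card_preimage_le:
  fixes K t y :: real
  assumes y: "y > 0" and K: "K = (1 + y)\<^sup>2 / y" and t: "K * t = y" and "p \<noteq> []"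
  shows "y * card {xs. distinct xs \<and> stack_sort xs = p} \<le> t * (K ^ length p * t ^ des p)"
proof -
  \<comment> \<open>A fictitious label above the first entry of \<open>p\<close> makes the first
    slot a leaf slot; this is the source of the extra factor \<open>t\<close>.\<close>
  let ?S = "{xs. distinct xs \<and> stack_sort xs = p}" and ?a = "Suc (hd p)"
  let ?W = "listset (slots ?a p)"
  have ne: "xs \<noteq> []" if "xs \<in> ?S" for xs using that assms(4) by auto
  have fin: "finite ?W"
    by (rule finite_listset) simp
  have inj: "inj_on (\<lambda>xs. word (dtree xs)) ?S"
    using word_dtree_inj ne by (intro inj_onI) auto
  have sub: "(\<lambda>xs. word (dtree xs)) ` ?S \<subseteq> ?W"
    using word_in_slots by auto
  have nonneg: "prod_list (map (wt y) w) \<ge> 0" for w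
  proof (induction w)
    case (Cons c w)
    have "wt y c \<ge> 0" using y by (cases "(y, c)" rule: wt.cases) auto
    then show ?case using Cons by simp
  qed simp
  have "y * card ?S = (\<Sum>xs\<in>?S. prod_list (map (wt y) (word (dtree xs))))"
    using y ne by (simp add: prod_wt_word dtree_eq_Leaf_iff)
  also have "\<dots> = (\<Sum>w\<in>(\<lambda>xs. word (dtree xs)) ` ?S. prod_list (map (wt y) w))"
    by (simp add: sum.reindex[OF inj])
  also have "\<dots> \<le> (\<Sum>w\<in>?W. prod_list (map (wt y) w))"
    by (rule sum_mono2[OF fin sub]) (rule nonneg)
  also have "\<dots> = K ^ length p * t ^ des (?a # p)"
    using y by (simp add: sum_prod_listset prod_slots[OF _ K t])
  also have "des (?a # p) = Suc (des p)" using assms(4) by (cases p) auto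
  finally show ?thesis by (simp add: mult_ac)
qed

text \<open>For a sortable \<open>xs\<close>, the list \<open>stack_sort (stack_sort xs)\<close>
  avoids 231. Grouping by p = \<open>stack_sort xs\<close>, the fibre bound depends only on
  \<open>n\<close> and \<open>des p\<close>, which the tree of p records; as \<open>dtree\<close> is
  injective here, the sum may be enlarged to all trees of size \<open>n\<close>.\<close>

lemma W3_le_tree_sum:
  fixes K t y :: real
  assumes y: "y > 0" and K: "K = (1 + y)\<^sup>2 / y" and t: "K * t = y" and n: "n > 0"
  shows "y * W3 n \<le> t * K ^ n * (\<Sum>T\<in>{T\<in>trees n. tsize T = n}. t ^ tdes T)"
proof -
  define P where "P = {p \<in> permutations_of_set {1..n}. av231 (stack_sort p)}"
  have finP: "finite P" unfolding P_def by simp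
  have K0: "K > 0" using y unfolding K by simp
  have t0: "t > 0" using t y K0 by (metis zero_less_mult_pos)
  have P: "distinct p" "set p = {1..n}" "length p = n" "av231 (stack_sort p)" if "p \<in> P" for p
    using that by (auto simp: P_def permutations_of_set_def distinct_card[symmetric])
  have "{p \<in> permutations_of_set {1..n}. three_stack_sortable n p} \<subseteq>
     (\<Union>p\<in>P. {xs. distinct xs \<and> stack_sort xs = p})"
  proof
    fix xs assume "xs \<in> {p \<in> permutations_of_set {1..n}. three_stack_sortable n p}"
    then have xs: "distinct xs" "set xs = {1..n}"
      and s3: "stack_sort (stack_sort (stack_sort xs)) = [1..<n+1]"
      by (auto simp: permutations_of_set_def three_stack_sortable_def eval_nat_numeral)
    let ?p = "stack_sort xs"
    have p: "distinct ?p" "set ?p = {1..n}" using xs by (simp_all add: stack_sort_distinct_simps)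
    have "sorted (stack_sort (stack_sort ?p))" unfolding s3 by (rule sorted_upt)
    then have "av231 (stack_sort ?p)"
      by (rule sorted_stack_sort_imp_av231[rotated]) (simp add: stack_sort_distinct_simps p)
    then have "?p \<in> P" using p by (auto simp: P_def permutations_of_set_def)
    then show "xs \<in> (\<Union>p\<in>P. {xs. distinct xs \<and> stack_sort xs = p})" using xs by blast
  qed
  moreover have fin: "finite {xs. distinct xs \<and> stack_sort xs = p}" if "p \<in> P" for p
  proof (rule finite_subset)
    show "{xs. distinct xs \<and> stack_sort xs = p} \<subseteq> permutations_of_set {1..n}"
      using stack_sort_distinct_simps(1) P(2)[OF that] unfolding permutations_of_set_def by blast
  qed simp
  ultimately have "W3 n \<le> card (\<Union>p\<in>P. {xs. distinct xs \<and> stack_sort xs = p})"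
    unfolding W3_def using finP by (intro card_mono) auto
  also have "\<dots> \<le> (\<Sum>p\<in>P. card {xs. distinct xs \<and> stack_sort xs = p})"
    by (rule card_UN_le[OF finP])
  finally have "real (W3 n) \<le> (\<Sum>p\<in>P. real (card {xs. distinct xs \<and> stack_sort xs = p}))"
    by (metis of_nat_le_iff of_nat_sum)
  then have "y * W3 n \<le> (\<Sum>p\<in>P. y * real (card {xs. distinct xs \<and> stack_sort xs = p}))"
    using y by (simp add: sum_distrib_left[symmetric])
  also have "\<dots> \<le> (\<Sum>p\<in>P. t * (K ^ n * t ^ des p))"
  proof (rule sum_mono)
    fix p assume p: "p \<in> P"
    then have "p \<noteq> []" using P(3) n by fastforce
    from card_preimage_le[OF y K t this]
    show "y * real (card {xs. distinct xs \<and> stack_sort xs = p}) \<le> t * (K ^ n * t ^ des p)"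
      by (simp add: P(3)[OF p])
  qed
  also have "\<dots> = t * K ^ n * (\<Sum>p\<in>P. t ^ tdes (dtree p))"
    unfolding sum_distrib_left
    by (rule sum.cong[OF refl]) (simp only: tdes_dtree[OF P(1)] mult.assoc)
  also have "(\<Sum>p\<in>P. t ^ tdes (dtree p)) = (\<Sum>T\<in>dtree ` P. t ^ tdes T)"
  proof -
    have "inj_on dtree P"
    proof (rule inj_onI)
      fix p q assume pq: "p \<in> P" "q \<in> P" "dtree p = dtree q"
      show "p = q"
        by (rule dtree_inj[OF P(1,4)[OF pq(1)] P(1,4)[OF pq(2)] _ pq(3)]) (simp only: P(2) pq)
    qed
    then show ?thesis by (simp add: sum.reindex)
  qed
  also have "\<dots> \<le> (\<Sum>T\<in>{T\<in>trees n. tsize T = n}. t ^ tdes T)"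
  proof (rule sum_mono2)
    show "dtree ` P \<subseteq> {T\<in>trees n. tsize T = n}"
    proof
      fix T assume "T \<in> dtree ` P"
      then obtain p where p: "p \<in> P" "T = dtree p" by blast
      have "dtree p \<in> trees n" using dtree_trees[OF P(1,4)[OF p(1)]] by (simp only: P(3)[OF p(1)])
      moreover have "tsize (dtree p) = n" by (simp only: tsize_dtree[OF P(1)[OF p(1)]] P(3)[OF p(1)])
      ultimately show "T \<in> {T\<in>trees n. tsize T = n}" using p(2) by blast
    qed
  qed (use t0 finite_trees in auto)
  finally show ?thesis using t0 K0 by simp
qed

section \<open>Weights of trees by number of components\<close>

text \<open>The number of blocks between consecutive cuts, which serves as the catalytic
  statistic.\<close>

definition comps :: "cut_tree \<Rightarrow> nat" where
  "comps T = card (cuts T) - 1"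

lemma tsize_in_cuts: "tsize T \<in> cuts T"
  by (cases T) auto

lemma comps_Leaf [simp]: "comps Leaf = 0"
  by (simp add: comps_def)

lemma card_cuts: "card (cuts T) = Suc (comps T)"
  unfolding comps_def using tsize_in_cuts[of T] finite_cuts[of T]
  by (metis Suc_diff_1 card_gt_0_iff empty_iff)

text \<open>Dropping the top cut of \<open>l\<close> leaves \<open>comps l\<close> cuts there, and
  the new cut at the very end is offset by the subtraction in \<open>comps\<close>.\<close>

lemma comps_Node: "comps (Node l j r) = comps l + card {k \<in> cuts r. j \<le> k}"
proof -
  let ?A = "{k \<in> cuts l. k < tsize l}" and ?B = "(+) (tsize l) ` {k \<in> cuts r. j \<le> k}"
  have A: "?A = cuts l - {tsize l}" using cuts_le_tsize[of _ l] by (auto simp: order_less_le)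
  have "card ?A = comps l"
    unfolding A using tsize_in_cuts[of l] finite_cuts[of l] by (simp add: card_cuts)
  moreover have "card ?B = card {k \<in> cuts r. j \<le> k}"
    by (rule card_image) simp
  moreover have "card (?A \<union> ?B) = card ?A + card ?B"
    by (rule card_Un_disjoint) (auto simp: finite_cuts)
  moreover have "Suc (tsize l + tsize r) \<notin> ?A \<union> ?B"
    using cuts_le_tsize[of _ r] by force
  ultimately show ?thesis
    unfolding comps_def[of "Node l j r"] by (simp add: finite_cuts)
qed

text \<open>Moving \<open>j\<close> down by one cut raises the count by one. For fixed subtrees
  \<open>l\<close> and \<open>r\<close> the labels thus yield each component number from
  \<open>comps l + 1\<close> to \<open>comps l + comps r + 1\<close> once.\<close>

lemma sum_over_upper_counts:
  fixes g :: "nat \<Rightarrow> real" and C :: "nat set"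
  assumes "finite C"
  shows "(\<Sum>j\<in>C. g (card {k \<in> C. j \<le> k})) = (\<Sum>i=1..card C. g i)"
  using assms
proof (induction rule: finite_linorder_min_induct)
  case (insert b A)
  have "(\<Sum>j\<in>A. g (card {k \<in> insert b A. j \<le> k})) = (\<Sum>j\<in>A. g (card {k \<in> A. j \<le> k}))"
  proof (rule sum.cong[OF refl])
    fix j assume "j \<in> A"
    then have "{k \<in> insert b A. j \<le> k} = {k \<in> A. j \<le> k}" using insert by auto
    then show "g (card {k \<in> insert b A. j \<le> k}) = g (card {k \<in> A. j \<le> k})" by simp
  qed
  moreover have "{k \<in> insert b A. b \<le> k} = insert b A" using insert by auto
  moreover have "b \<notin> A" using insert by auto
  ultimately show ?case using insert by simp
qed simp

definition tweight :: "real \<Rightarrow> real \<Rightarrow> cut_tree \<Rightarrow> real" where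
  "tweight z t T = z ^ tsize T * t ^ tdes T"

lemma tweight_simps [simp]:
  "tweight z t Leaf = 1"
  "tweight z t (Node l j r) = z * tweight z t l * tweight z t r * (if r = Leaf then 1 else t)"
  by (simp_all add: tweight_def power_add)

lemma trees_Suc_image:
  "trees (Suc h) - {Leaf} \<subseteq>
     (\<lambda>(l, r, j). Node l j r) ` (SIGMA l:trees h. SIGMA r:trees h. if l = Leaf then {0} else cuts r)"
  by force

text \<open>Removing the root gives an exact recursion for the weights of trees by number of components.
  It has nonnegative terms, so any nonnegative solution \<open>v\<close> with tail sums bounded by \<open>\<tau>\<close> bounds the
  weights, and no enumeration of the trees is needed.\<close>
context
  fixes z t :: real and v \<tau> :: "nat \<Rightarrow> real"
  assumes z: "z \<ge> 0" and t: "t \<ge> 0" and v: "\<And>c. v c \<ge> 0" and tau: "\<And>i. \<tau> i \<ge> 0"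
    and tau_Suc: "\<And>i. \<tau> (Suc i) = \<tau> i - v i"
    and v_Suc: "\<And>c. v (Suc c) = z * (of_bool (c = 0) + (1 + t) * v c + t * (\<Sum>a\<le>c. v a * \<tau> (c - a)))"
begin

lemma tweight_nonneg: "tweight z t T \<ge> 0"
  unfolding tweight_def using z t by simp

lemma tail_sum_le:
  assumes A: "\<And>c. (\<Sum>T\<in>{T \<in> S. comps T = c}. tweight z t T) \<le> v c" and "finite S"
  shows "(\<Sum>T\<in>{T \<in> S. i \<le> comps T}. tweight z t T) \<le> \<tau> i"
proof -
  define B where "B = Max (comps ` S \<union> {i})"
  have B: "comps T \<le> B" if "T \<in> S" for T
    unfolding B_def using that assms(2) by (intro Max_ge) auto
  have iB: "i \<le> B" unfolding B_def using assms(2) by (intro Max_ge) auto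
  let ?S = "{T \<in> S. i \<le> comps T}"
  have "(\<Sum>T\<in>?S. tweight z t T) = (\<Sum>c\<in>{i..B}. \<Sum>T\<in>{T \<in> ?S. comps T = c}. tweight z t T)"
    by (rule sum.group[symmetric]) (use assms(2) B in auto)
  also have "\<dots> \<le> (\<Sum>c\<in>{i..B}. v c)"
  proof (rule sum_mono)
    fix c assume "c \<in> {i..B}"
    then have "{T \<in> ?S. comps T = c} = {T \<in> S. comps T = c}" by auto
    then show "(\<Sum>T\<in>{T \<in> ?S. comps T = c}. tweight z t T) \<le> v c" using A by simp
  qed
  \<comment> \<open>The sum telescopes, since \<open>v c\<close> is
    \<open>\<tau> c - \<tau> (Suc c)\<close>.\<close>
  also have "\<dots> = \<tau> i - \<tau> (Suc B)"
    using iB by (induction B rule: dec_induct) (simp_all add: tau_Suc)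
  also have "\<dots> \<le> \<tau> i" using tau by simp
  finally show ?thesis .
qed

text \<open>Induction on the height bound, with c = \<open>Suc c'\<close>. A left leaf accounts for
  \<open>z * of_bool (c' = 0) + z * t * v c'\<close>, a right leaf beside a nonempty left subtree
  for \<open>z * v c'\<close>. If both subtrees are nonempty and the left one has \<open>a\<close>
  components, the right one needs at least \<open>c' - a\<close>, and then exactly one label fits;
  this gives the convolution of \<open>v\<close> with \<open>\<tau>\<close>.\<close>

lemma trees_comps_sum_le:
  "(\<Sum>T\<in>{T \<in> trees h - {Leaf}. comps T = c}. tweight z t T) \<le> v c"
proof (induction h arbitrary: c)
  case 0
  then show ?case using v by simp
next
  case (Suc h)
  let ?w = "tweight z t"
  let ?N = "trees h - {Leaf}"
  let ?P = "SIGMA l:trees h. SIGMA r:trees h. if l = Leaf then {0} else cuts r"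
  define f where "f l r = z * ?w l * ?w r * (if r = Leaf then 1 else t)" for l r
  have f0: "f l r \<ge> 0" for l r unfolding f_def using z t tweight_nonneg by simp
  have finN: "finite (trees h)" "finite ?N" using finite_trees by auto
  have LN: "trees h = insert Leaf ?N" by (cases h) auto
  show ?case
  proof (cases c)
    case 0
    \<comment> \<open>\<open>tsize r\<close> is a cut not below the label, so every node has at
      least one component.\<close>
    have *: "{T \<in> trees (Suc h) - {Leaf}. comps T = 0} = {}"
    proof (rule equals0I)
      fix T assume "T \<in> {T \<in> trees (Suc h) - {Leaf}. comps T = 0}"
      then obtain l j r where T: "T = Node l j r" "j \<in> cuts r" "comps T = 0" by auto
      then have "tsize r \<in> {k \<in> cuts r. j \<le> k}" using tsize_in_cuts cuts_le_tsize by simp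
      then have "card {k \<in> cuts r. j \<le> k} > 0"
        using finite_cuts[of r] by (auto simp: card_gt_0_iff)
      then show False using T by (simp add: comps_Node)
    qed
    show ?thesis unfolding 0 * using v by simp
  next
    case (Suc c')
    have inj: "inj_on (\<lambda>(l, r, j). Node l j r) X" for X by (auto simp: inj_on_def)
    have fin: "finite ?P" using finN finite_cuts by auto
    have "(\<Sum>T\<in>{T \<in> trees (Suc h) - {Leaf}. comps T = c}. ?w T)
      \<le> (\<Sum>T\<in>(\<lambda>(l, r, j). Node l j r) ` ?P. if comps T = c then ?w T else 0)"
      unfolding sum.inter_filter[OF finite_imageI[OF fin], symmetric]
      using trees_Suc_image[of h] fin by (intro sum_mono2) (auto intro: tweight_nonneg)
    also have "\<dots> = (\<Sum>(l, r, j)\<in>?P. of_bool (comps l + card {k \<in> cuts r. j \<le> k} = c) * f l r)"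
      by (subst sum.reindex[OF inj]) (auto simp: comps_Node f_def intro!: sum.cong)
    also have "\<dots> = (\<Sum>l\<in>trees h. \<Sum>r\<in>trees h. \<Sum>j\<in>(if l = Leaf then {0} else cuts r).
        of_bool (comps l + card {k \<in> cuts r. j \<le> k} = c) * f l r)"
      using finN finite_cuts by (subst sum.Sigma, simp, simp, subst sum.Sigma) auto
    \<comment> \<open>With a left leaf the label is 0, so all \<open>comps r + 1\<close> cuts of the
      right subtree are counted.\<close>
    also have "\<dots> = (\<Sum>r\<in>trees h. of_bool (comps r = c') * f Leaf r)
      + (\<Sum>l\<in>?N. \<Sum>r\<in>trees h. \<Sum>j\<in>cuts r. of_bool (comps l + card {k \<in> cuts r. j \<le> k} = c) * f l r)"
      by (subst LN, subst sum.insert) (use finN in \<open>auto simp: card_cuts Suc intro!: sum.cong\<close>)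
    also have "(\<Sum>l\<in>?N. \<Sum>r\<in>trees h. \<Sum>j\<in>cuts r. of_bool (comps l + card {k \<in> cuts r. j \<le> k} = c) * f l r)
      = (\<Sum>l\<in>?N. \<Sum>r\<in>trees h. of_bool (comps l \<le> c' \<and> c' - comps l \<le> comps r) * f l r)"
    proof (intro sum.cong refl)
      fix l r
      have "(\<Sum>j\<in>cuts r. of_bool (comps l + card {k \<in> cuts r. j \<le> k} = c) * f l r)
        = (\<Sum>i=1..Suc (comps r). of_bool (comps l + i = c) * f l r)"
        by (subst sum_over_upper_counts[OF finite_cuts, of "\<lambda>i. of_bool (comps l + i = c) * f l r"])
          (simp only: card_cuts)
      also have "\<dots> = (\<Sum>i=1..Suc (comps r). if i = c - comps l then of_bool (comps l \<le> c') * f l r else 0)"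
        by (intro sum.cong refl) (auto simp: Suc)
      also have "\<dots> = of_bool (comps l \<le> c' \<and> c' - comps l \<le> comps r) * f l r"
        by (subst sum.delta) (auto simp: Suc)
      finally show "(\<Sum>j\<in>cuts r. of_bool (comps l + card {k \<in> cuts r. j \<le> k} = c) * f l r)
        = of_bool (comps l \<le> c' \<and> c' - comps l \<le> comps r) * f l r" .
    qed
    also have "(\<Sum>r\<in>trees h. of_bool (comps r = c') * f Leaf r)
       \<le> z * of_bool (c' = 0) + z * t * v c'"
    proof -
      have "(\<Sum>r\<in>trees h. of_bool (comps r = c') * f Leaf r)
        = z * of_bool (c' = 0) + (\<Sum>r\<in>?N. of_bool (comps r = c') * f Leaf r)"
        by (subst LN, subst sum.insert) (use finN in \<open>auto simp: f_def\<close>)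
      also have "(\<Sum>r\<in>?N. of_bool (comps r = c') * f Leaf r) = z * t * (\<Sum>r\<in>{r \<in> ?N. comps r = c'}. ?w r)"
        unfolding sum.inter_filter[OF finN(2)] sum_distrib_left
        by (intro sum.cong refl) (auto simp: f_def)
      also have "\<dots> \<le> z * t * v c'" using z t Suc.IH by (intro mult_left_mono) auto
      finally show ?thesis by simp
    qed
    also have "(\<Sum>l\<in>?N. \<Sum>r\<in>trees h. of_bool (comps l \<le> c' \<and> c' - comps l \<le> comps r) * f l r)
      \<le> z * v c' + z * t * (\<Sum>a\<le>c'. v a * \<tau> (c' - a))"
    proof -
      have "(\<Sum>l\<in>?N. \<Sum>r\<in>trees h. of_bool (comps l \<le> c' \<and> c' - comps l \<le> comps r) * f l r)
        = (\<Sum>l\<in>?N. of_bool (comps l = c') * (z * ?w l)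
           + of_bool (comps l \<le> c') * (z * t * ?w l * (\<Sum>r\<in>{r \<in> ?N. c' - comps l \<le> comps r}. ?w r)))"
      proof (intro sum.cong refl)
        fix l
        have "(\<Sum>r\<in>trees h. of_bool (comps l \<le> c' \<and> c' - comps l \<le> comps r) * f l r)
         = of_bool (comps l = c') * (z * ?w l)
           + (\<Sum>r\<in>?N. of_bool (comps l \<le> c' \<and> c' - comps l \<le> comps r) * f l r)"
          by (subst LN, subst sum.insert) (use finN in \<open>auto simp: f_def\<close>)
        also have "(\<Sum>r\<in>?N. of_bool (comps l \<le> c' \<and> c' - comps l \<le> comps r) * f l r)
          = of_bool (comps l \<le> c') * (z * t * ?w l * (\<Sum>r\<in>{r \<in> ?N. c' - comps l \<le> comps r}. ?w r))"
          unfolding sum.inter_filter[OF finN(2)] sum_distrib_left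
          by (intro sum.cong refl) (auto simp: f_def)
        finally show "(\<Sum>r\<in>trees h. of_bool (comps l \<le> c' \<and> c' - comps l \<le> comps r) * f l r)
         = of_bool (comps l = c') * (z * ?w l)
           + of_bool (comps l \<le> c') * (z * t * ?w l * (\<Sum>r\<in>{r \<in> ?N. c' - comps l \<le> comps r}. ?w r))" .
      qed
      also have "\<dots> \<le> (\<Sum>l\<in>?N. of_bool (comps l = c') * (z * ?w l)
           + of_bool (comps l \<le> c') * (z * t * ?w l * \<tau> (c' - comps l)))"
        using z t tweight_nonneg tail_sum_le[OF Suc.IH finN(2)]
        by (intro sum_mono add_left_mono mult_left_mono) auto
      also have "\<dots> = z * (\<Sum>l\<in>{l\<in>?N. comps l = c'}. ?w l)
           + z * t * (\<Sum>l\<in>{l\<in>?N. comps l \<le> c'}. ?w l * \<tau> (c' - comps l))"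
        unfolding sum.distrib sum.inter_filter[OF finN(2)] sum_distrib_left
        by (intro arg_cong2[where f = "(+)"] sum.cong refl) auto
      also have "(\<Sum>l\<in>{l\<in>?N. comps l \<le> c'}. ?w l * \<tau> (c' - comps l))
        = (\<Sum>a\<le>c'. \<Sum>l\<in>{l\<in>{l\<in>?N. comps l \<le> c'}. comps l = a}. ?w l * \<tau> (c' - comps l))"
        by (rule sum.group[symmetric]) (use finN in auto)
      also have "\<dots> = (\<Sum>a\<le>c'. (\<Sum>l\<in>{l\<in>?N. comps l = a}. ?w l) * \<tau> (c' - a))"
        unfolding sum_distrib_right by (intro sum.cong refl) auto
      also have "z * (\<Sum>l\<in>{l\<in>?N. comps l = c'}. ?w l)
           + z * t * (\<Sum>a\<le>c'. (\<Sum>l\<in>{l\<in>?N. comps l = a}. ?w l) * \<tau> (c' - a))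
        \<le> z * v c' + z * t * (\<Sum>a\<le>c'. v a * \<tau> (c' - a))"
        using z t tau Suc.IH by (intro add_mono mult_left_mono sum_mono mult_right_mono) auto
      finally show ?thesis .
    qed
    finally show ?thesis
      unfolding Suc v_Suc by (simp add: algebra_simps)
  qed
qed

lemma trees_size_sum_le:
  assumes "n > 0"
  shows "z ^ n * (\<Sum>T\<in>{T \<in> trees h. tsize T = n}. t ^ tdes T) \<le> \<tau> 0"
proof -
  have "z ^ n * (\<Sum>T\<in>{T \<in> trees h. tsize T = n}. t ^ tdes T) = (\<Sum>T\<in>{T \<in> trees h. tsize T = n}. tweight z t T)"
    by (simp add: sum_distrib_left tweight_def)
  also have "\<dots> \<le> (\<Sum>T\<in>{T \<in> trees h - {Leaf}. 0 \<le> comps T}. tweight z t T)"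
    using assms finite_trees by (intro sum_mono2) (auto intro: tweight_nonneg)
  also have "\<dots> \<le> \<tau> 0"
    by (rule tail_sum_le[OF trees_comps_sum_le]) (simp add: finite_trees)
  finally show ?thesis .
qed

end

section \<open>The critical solution of the recursion\<close>

lemma fps_sums_X_mult:
  fixes F :: "real fps"
  assumes "fps_nth F sums s"
  shows "fps_nth (fps_X * F) sums s"
proof -
  have "(\<lambda>n. fps_nth (fps_X * F) (Suc n)) sums s" using assms by simp
  then show ?thesis using sums_Suc_iff[of "fps_nth (fps_X * F)" s] by simp
qed

lemma fps_sums_mult:
  fixes F G :: "real fps"
  assumes "fps_nth F sums s" "fps_nth G sums r" "\<And>n. fps_nth F n \<ge> 0" "\<And>n. fps_nth G n \<ge> 0"
  shows "fps_nth (F * G) sums (s * r)"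
proof -
  have "summable (\<lambda>n. norm (fps_nth F n))" "summable (\<lambda>n. norm (fps_nth G n))"
    using assms by (auto simp: sums_iff)
  from Cauchy_product_sums[OF this]
  have "(\<lambda>k. \<Sum>i\<le>k. fps_nth F i * fps_nth G (k - i)) sums (s * r)"
    using assms(1,2) by (simp add: sums_iff)
  also have "(\<lambda>k. \<Sum>i\<le>k. fps_nth F i * fps_nth G (k - i)) = fps_nth (F * G)"
    by (simp add: fun_eq_iff fps_mult_nth atLeast0AtMost)
  finally show ?thesis .
qed

text \<open>The recurrence compares coefficients in 2 q P' = P q', the differential equation
  satisfied by a square root P of the quadratic q.\<close>

lemma sqrt_quadratic_fps:
  fixes \<alpha> b :: real
  obtains P :: "real fps" where
    "P\<^sup>2 = (1 - fps_const \<alpha> * fps_X) * (1 - fps_const b * fps_X)"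
    "fps_nth P 0 = 1" "fps_nth P 1 = - (\<alpha> + b) / 2"
    "\<And>n. 2 * (n + 2) * fps_nth P (n + 2) =
       (\<alpha> + b) * (2 * n + 1) * fps_nth P (n + 1) - 2 * \<alpha> * b * (real n - 1) * fps_nth P n"
proof -
  define q where "q = (1 - fps_const \<alpha> * fps_X) * (1 - fps_const b * fps_X :: real fps)"
  have q0: "fps_nth q 0 = 1" by (simp add: q_def)
  define P where "P = fps_radical (\<lambda>_ _. 1) 2 q"
  have P2: "P\<^sup>2 = q"
    using power_radical[of q "\<lambda>_ _. 1" 1] q0 by (simp add: P_def eval_nat_numeral)
  have P0: "fps_nth P 0 = 1" by (simp add: P_def)
  have q: "q = 1 - fps_const (\<alpha> + b) * fps_X + fps_const (\<alpha> * b) * fps_X\<^sup>2"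
    by (simp add: q_def algebra_simps power2_eq_square flip: fps_const_mult fps_const_add)
  have q': "fps_deriv q = - fps_const (\<alpha> + b) + fps_const (2 * \<alpha> * b) * fps_X"
    unfolding q by (simp add: fps_deriv_power algebra_simps fps_numeral_fps_const)
  have "fps_deriv (P\<^sup>2) = 2 * P * fps_deriv P"
    by (simp add: power2_eq_square algebra_simps)
  then have "P * fps_deriv (P\<^sup>2) = 2 * P\<^sup>2 * fps_deriv P"
    by (simp add: power2_eq_square algebra_simps)
  then have ode: "fps_const 2 * (q * fps_deriv P) = P * fps_deriv q"
    by (simp add: P2 mult.assoc fps_numeral_fps_const)
  have lhs: "q * fps_deriv P = fps_deriv P - fps_const (\<alpha> + b) * (fps_X * fps_deriv P)
      + fps_const (\<alpha> * b) * (fps_X * (fps_X * fps_deriv P))"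
    unfolding q by (simp add: algebra_simps power2_eq_square del: fps_const_add fps_const_mult)
  have rhs: "P * fps_deriv q = fps_const (2 * \<alpha> * b) * (fps_X * P) - fps_const (\<alpha> + b) * P"
    unfolding q' by (simp add: algebra_simps del: fps_const_add fps_const_mult fps_const_neg)
  have nth: "fps_nth (fps_const 2 * (q * fps_deriv P)) n = fps_nth (P * fps_deriv q) n" for n
    by (simp add: ode)
  show thesis
  proof (rule that[of P])
    show "P\<^sup>2 = (1 - fps_const \<alpha> * fps_X) * (1 - fps_const b * fps_X)" using P2 q_def by simp
    show "fps_nth P 0 = 1" by (rule P0)
    show "fps_nth P 1 = - (\<alpha> + b) / 2"
      using nth[of 0] P0 unfolding lhs rhs by simp
    show "2 * (n + 2) * fps_nth P (n + 2) =
       (\<alpha> + b) * (2 * n + 1) * fps_nth P (n + 1) - 2 * \<alpha> * b * (real n - 1) * fps_nth P n" for n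
      using nth[of "Suc n"] unfolding lhs rhs
      by (cases n) (simp_all add: algebra_simps)
  qed
qed

text \<open>M enumerates Motzkin paths with weight \<open>\<beta>\<close> per level step and
  \<open>\<gamma>\<close> per pair of up and down steps. The discriminant (1 - \<beta> X)^2 - 4
  \<gamma> X^2 of its equation factors as (1 - \<alpha> X) (1 - b X), so M is read off from the
  square root P. The ratio bound later makes the critical solution nonnegative.\<close>

lemma weighted_motzkin_fps:
  fixes \<alpha> b :: real
  assumes b: "0 < b" "b < \<alpha>"
  defines "\<beta> \<equiv> (\<alpha> + b) / 2" and "\<gamma> \<equiv> ((\<alpha> - b) / 4)\<^sup>2"
  obtains M :: "real fps" where
    "M = 1 + fps_const \<beta> * fps_X * M + fps_const \<gamma> * fps_X\<^sup>2 * M\<^sup>2"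
    "\<And>n. fps_nth M n > 0" "\<And>n. fps_nth M (Suc n) \<le> \<alpha> * fps_nth M n"
proof -
  have \<gamma>: "\<gamma> > 0" and \<beta>: "\<beta> > 0" using b by (auto simp: \<gamma>_def \<beta>_def)
  obtain P :: "real fps" where
    P2: "P\<^sup>2 = (1 - fps_const \<alpha> * fps_X) * (1 - fps_const b * fps_X)" and
    P0: "fps_nth P 0 = 1" and P1: "fps_nth P 1 = - (\<alpha> + b) / 2" and
    PS: "\<And>n. 2 * (n + 2) * fps_nth P (n + 2) =
       (\<alpha> + b) * (2 * n + 1) * fps_nth P (n + 1) - 2 * \<alpha> * b * (real n - 1) * fps_nth P n"
    by (rule sqrt_quadratic_fps[of \<alpha> b]) blast
  define M where "M = Abs_fps (\<lambda>k. - fps_nth P (k + 2) / (2 * \<gamma>))"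
  have M_nth: "fps_nth P (k + 2) = - 2 * \<gamma> * fps_nth M k" for k
    using \<gamma> by (simp add: M_def)
  let ?X = "fps_X :: real fps"
  let ?B = "fps_const \<beta>" and ?G = "fps_const \<gamma>"
  have P: "P = 1 - ?B * ?X - 2 * ?G * ?X\<^sup>2 * M"
  proof (rule fps_ext)
    fix n :: nat
    consider "n = 0" | "n = 1" | k where "n = k + 2"
      by (metis One_nat_def add_2_eq_Suc' not0_implies_Suc)
    then show "fps_nth P n = fps_nth (1 - ?B * ?X - 2 * ?G * ?X\<^sup>2 * M) n"
    proof cases
      case 3
      then show ?thesis
        by (simp add: M_nth power2_eq_square mult.assoc fps_numeral_fps_const del: add_2_eq_Suc')
    qed (use P0 P1 in \<open>simp_all add: power2_eq_square mult.assoc fps_numeral_fps_const \<beta>_def field_simps\<close>)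
  qed
  have M0: "fps_nth M 0 = 1"
  proof -
    have "4 * fps_nth P 2 = - (\<alpha> - b)\<^sup>2 / 2"
    proof -
      have "4 * fps_nth P 2 = (\<alpha> + b) * fps_nth P 1 + 2 * \<alpha> * b * fps_nth P 0"
        using PS[of 0] by (simp add: numeral_2_eq_2)
      then show ?thesis unfolding P0 P1 by (simp add: field_simps power2_eq_square)
    qed
    moreover have "4 * fps_nth P 2 = - 8 * \<gamma> * fps_nth M 0" using M_nth[of 0] by (simp add: numeral_2_eq_2)
    ultimately have "\<gamma> * fps_nth M 0 = \<gamma>" by (simp add: \<gamma>_def power2_eq_square)
    then show ?thesis using \<gamma> by simp
  qed
  have ab: "\<alpha> + b = 2 * \<beta>" "\<alpha> * b = \<beta>\<^sup>2 - 4 * \<gamma>"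
    by (simp_all add: \<beta>_def \<gamma>_def power2_eq_square field_simps)
  have rec: "M = 1 + ?B * ?X * M + ?G * ?X\<^sup>2 * M\<^sup>2"
  proof -
    have "P\<^sup>2 = 1 - fps_const (\<alpha> + b) * ?X + fps_const (\<alpha> * b) * ?X\<^sup>2"
      unfolding P2 by (simp add: algebra_simps power2_eq_square flip: fps_const_mult fps_const_add)
    also have "\<dots> = (1 - ?B * ?X)\<^sup>2 - 4 * ?G * ?X\<^sup>2"
      unfolding ab
      by (simp add: algebra_simps power2_eq_square fps_numeral_fps_const
        flip: fps_const_mult fps_const_add fps_const_sub)
    finally have "(4 * ?G * ?X\<^sup>2) * (1 + ?B * ?X * M + ?G * ?X\<^sup>2 * M\<^sup>2 - M) = 0"
      unfolding P by (simp add: algebra_simps power2_eq_square del: fps_const_mult)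
    moreover have "4 * ?G * ?X\<^sup>2 \<noteq> 0" using \<gamma> by simp
    ultimately show ?thesis by simp
  qed
  have nth_rec: "fps_nth M (Suc n) \<ge> \<beta> * fps_nth M n" if "\<And>k. k \<le> n \<Longrightarrow> fps_nth M k \<ge> 0" for n
  proof -
    have "fps_nth M (Suc n) = \<beta> * fps_nth M n + \<gamma> * fps_nth (?X * M\<^sup>2) n"
      by (subst rec) (simp add: mult.assoc power2_eq_square[of ?X])
    moreover have "fps_nth (?X * M\<^sup>2) n \<ge> 0"
      using that by (cases n) (auto simp: power2_eq_square fps_mult_nth intro!: sum_nonneg mult_nonneg_nonneg)
    ultimately show ?thesis using \<gamma> by simp
  qed
  have pos: "fps_nth M n > 0" for n
  proof (induction n rule: less_induct)
    case (less n)
    show ?case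
    proof (cases n)
      case (Suc m)
      have "\<beta> * fps_nth M m \<le> fps_nth M n"
        unfolding Suc by (rule nth_rec) (use less Suc in \<open>auto intro: less_imp_le\<close>)
      moreover have "\<beta> * fps_nth M m > 0" using \<beta> less Suc by simp
      ultimately show ?thesis by simp
    qed (simp add: M0)
  qed
  have "fps_nth M (Suc n) \<le> \<alpha> * fps_nth M n" for n
  proof (induction n)
    case 0
    have "fps_nth M (Suc 0) = \<beta>" by (subst rec) (simp add: mult.assoc power2_eq_square[of ?X] M0)
    then show ?case using M0 b by (simp add: \<beta>_def)
  next
    case (Suc k)
    have "2 * \<gamma> * (2 * (k + 4) * fps_nth M (k + 2))
      = 2 * \<gamma> * ((\<alpha> + b) * (2 * k + 5) * fps_nth M (k + 1) - 2 * b * (k + 1) * (\<alpha> * fps_nth M k))"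
      using PS[of "k + 2"] M_nth[of "k + 2"] M_nth[of "k + 1"] M_nth[of k]
      by (simp add: algebra_simps numeral_eq_Suc)
    then have "2 * (k + 4) * fps_nth M (k + 2)
      = (\<alpha> + b) * (2 * k + 5) * fps_nth M (k + 1) - 2 * b * (k + 1) * (\<alpha> * fps_nth M k)"
      unfolding mult_cancel_left using \<gamma> by simp
    \<comment> \<open>The last term is subtracted, so the induction hypothesis serves as a lower
      bound for \<open>\<alpha> * fps_nth M k\<close>. What remains is a multiple 3 b, absorbed by b
      < \<alpha>.\<close>
    also have "\<dots> \<le> (\<alpha> + b) * (2 * k + 5) * fps_nth M (k + 1) - 2 * b * (k + 1) * fps_nth M (k + 1)"
      using b Suc.IH by (intro diff_left_mono mult_left_mono) auto
    also have "\<dots> = (\<alpha> * (2 * k + 5) + 3 * b) * fps_nth M (k + 1)"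
      by (simp add: algebra_simps)
    also have "\<dots> \<le> (\<alpha> * (2 * (k + 4))) * fps_nth M (k + 1)"
      using b pos[of "k + 1"] by (intro mult_right_mono) (auto simp: algebra_simps)
    finally have "2 * (real k + 4) * fps_nth M (k + 2) \<le> 2 * (real k + 4) * (\<alpha> * fps_nth M (k + 1))"
      by (simp add: mult_ac)
    then show ?case by (simp add: mult_le_cancel_left)
  qed
  with rec pos that show thesis by blast
qed

text \<open>Eliminating \<open>T\<close> from \<open>(1 - X) T = s - X V\<close> and \<open>V = z X (1 + (1 + t) V + t V T)\<close> leaves a
  quadratic equation for \<open>V\<close>. Under the four identities its discriminant is \<open>(1 - \<alpha> X)\<^sup>3 (1 - b X)\<close>,
  so \<open>V\<close> is a linear expression in the square root of \<open>(1 - \<alpha> X) (1 - b X)\<close>. Evaluating the quadratic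
  equation at \<open>1\<close> identifies \<open>s\<close> with the sum of the coefficients of \<open>V\<close>; hence the coefficients of
  \<open>T\<close> are its tail sums.\<close>
lemma critical_fixed_point:
  fixes \<alpha> b z t \<kappa> s :: real
  defines "\<beta> \<equiv> (\<alpha> + b) / 2" and "\<gamma> \<equiv> ((\<alpha> - b) / 4)\<^sup>2"
  assumes ord: "0 < b" "b < \<alpha>" "\<alpha> < 1" and pos: "z > 0" "t > 0" "\<kappa> > 0"
    and \<gamma>: "\<gamma> = z * t * \<kappa>"
    and id1: "\<alpha> + \<beta> = 1 + z * (1 + t) + z * t * s"
    and id2: "\<alpha> * \<beta> = z * (1 + t) + 2 * \<gamma>"
    and id3: "2 * \<alpha> = 1 + z / \<kappa> + z * (1 + t) + z * t * s"
    and id4: "\<alpha>\<^sup>2 = z / \<kappa> + z * (1 + t) + \<gamma>"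
  obtains v \<tau> :: "nat \<Rightarrow> real" where
    "\<And>c. v c \<ge> 0" "\<And>i. \<tau> i \<ge> 0" "\<And>i. \<tau> (Suc i) = \<tau> i - v i"
    "\<And>c. v (Suc c) = z * (of_bool (c = 0) + (1 + t) * v c + t * (\<Sum>a\<le>c. v a * \<tau> (c - a)))"
proof -
  obtain M :: "real fps" where
    M: "M = 1 + fps_const \<beta> * fps_X * M + fps_const \<gamma> * fps_X\<^sup>2 * M\<^sup>2" and
    Mpos: "\<And>n. fps_nth M n > 0" and Mle: "\<And>n. fps_nth M (Suc n) \<le> \<alpha> * fps_nth M n"
    using weighted_motzkin_fps[OF ord(1,2)] unfolding \<beta>_def \<gamma>_def by blast
  let ?X = "fps_X :: real fps"
  let ?C = "fps_const :: real \<Rightarrow> real fps"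
  define N where "N = (1 - ?C \<alpha> * ?X) * M"
  \<comment> \<open>An ansatz linear in the square root; its coefficients are nonnegative by
    \<open>Mle\<close>.\<close>
  define V where "V = ?C \<kappa> * (1 - N)"
  define T where "T = Abs_fps (\<lambda>i. s - (\<Sum>j<i. fps_nth V j))"
  have M0: "fps_nth M 0 = 1" by (subst M) simp
  have V0: "fps_nth V 0 = 0" by (simp add: V_def N_def M0)
  have V_Suc: "fps_nth V (Suc n) = \<kappa> * (\<alpha> * fps_nth M n - fps_nth M (Suc n))" for n
    by (simp add: V_def N_def algebra_simps)
  have V_nonneg: "fps_nth V n \<ge> 0" for n
    using V0 V_Suc Mle pos by (cases n) (auto intro!: mult_nonneg_nonneg)
  have M_le_power: "fps_nth M n \<le> \<alpha> ^ n" for n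
  proof (induction n)
    case (Suc n)
    then show ?case using Mle[of n] ord by (smt (verit, best) mult_left_mono power_Suc)
  qed (simp add: M0)
  have T_eq: "(1 - ?X) * T = ?C s - ?X * V"
  proof (rule fps_ext)
    fix n show "fps_nth ((1 - ?X) * T) n = fps_nth (?C s - ?X * V) n"
      by (cases n) (simp_all add: T_def algebra_simps)
  qed
  \<comment> \<open>The quadratic equation of \<open>M\<close> times the square of
    \<open>1 - ?C \<alpha> * ?X\<close>; it eliminates the square of \<open>N\<close> below.\<close>
  have N_eq: "?C \<gamma> * ?X\<^sup>2 * N\<^sup>2 = N * (1 - ?C \<alpha> * ?X) * (1 - ?C \<beta> * ?X) - (1 - ?C \<alpha> * ?X)\<^sup>2"
  proof -
    have "?C \<gamma> * ?X\<^sup>2 * M\<^sup>2 = M - 1 - ?C \<beta> * ?X * M" by (subst (2) M) simp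
    then have "(1 - ?C \<alpha> * ?X)\<^sup>2 * (?C \<gamma> * ?X\<^sup>2 * M\<^sup>2) = (1 - ?C \<alpha> * ?X)\<^sup>2 * (M - 1 - ?C \<beta> * ?X * M)"
      by simp
    then show ?thesis unfolding N_def by (simp add: algebra_simps power2_eq_square)
  qed
  define h where "h = z / \<kappa>"
  define g where "g = z * (1 + t)"
  define u where "u = z * t * s"
  have zh: "?C z = ?C \<kappa> * ?C h" using pos by (simp add: h_def)
  have "(1 - ?X) * V - ?C z * ?X * (1 - ?X) - ?C g * ?X * (1 - ?X) * V - ?C u * ?X * V
     + ?C (z * t) * ?X\<^sup>2 * V\<^sup>2 =
     ?C \<kappa> * ((1 - ?X) * (1 - N) - ?C h * ?X * (1 - ?X) - ?C g * ?X * (1 - ?X) * (1 - N)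
       - ?C u * ?X * (1 - N) + ?C \<gamma> * ?X\<^sup>2 * (1 - 2 * N) + ?C \<gamma> * ?X\<^sup>2 * N\<^sup>2)"
    unfolding V_def zh \<gamma> by (simp add: algebra_simps power2_eq_square flip: fps_const_mult)
  \<comment> \<open>Only multiples of N X, N X^2, X and X^2 survive, and the four identities say
    that their coefficients vanish.\<close>
  also have "\<dots> = ?C \<kappa> * (N * ?X * (1 + ?C g + ?C u - ?C \<alpha> - ?C \<beta>)
       + N * ?X\<^sup>2 * (?C \<alpha> * ?C \<beta> - ?C g - 2 * ?C \<gamma>)
       + ?X * (2 * ?C \<alpha> - 1 - ?C h - ?C g - ?C u)
       + ?X\<^sup>2 * (?C h + ?C g + ?C \<gamma> - ?C \<alpha> * ?C \<alpha>))"
    unfolding N_eq by (simp add: algebra_simps power2_eq_square del: fps_const_mult fps_const_add fps_const_sub)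
  also have "1 + ?C g + ?C u - ?C \<alpha> - ?C \<beta> = 0"
    unfolding fps_const_1_eq_1[symmetric] using id1 by (simp add: g_def u_def del: fps_const_1_eq_1)
  also have "?C \<alpha> * ?C \<beta> - ?C g - 2 * ?C \<gamma> = 0"
    using id2 by (simp add: g_def fps_numeral_fps_const)
  also have "2 * ?C \<alpha> - 1 - ?C h - ?C g - ?C u = 0"
    unfolding fps_const_1_eq_1[symmetric]
    using id3 by (simp add: g_def u_def h_def fps_numeral_fps_const del: fps_const_1_eq_1)
  also have "?C h + ?C g + ?C \<gamma> - ?C \<alpha> * ?C \<alpha> = 0"
    using id4 by (simp add: g_def h_def power2_eq_square)
  finally have quad: "(1 - ?X) * V - ?C z * ?X * (1 - ?X) - ?C g * ?X * (1 - ?X) * V - ?C u * ?X * V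
     + ?C (z * t) * ?X\<^sup>2 * V\<^sup>2 = 0" by simp
  have "(1 - ?X) * V = (1 - ?X) * (?C z * ?X * (1 + ?C (1 + t) * V + ?C t * V * T))"
  proof -
    have "(1 - ?X) * (?C z * ?X * (1 + ?C (1 + t) * V + ?C t * V * T))
       = ?C z * ?X * ((1 - ?X) + (1 - ?X) * ?C (1 + t) * V + ?C t * V * ((1 - ?X) * T))"
      by (simp add: algebra_simps del: fps_const_add fps_const_mult)
    also have "\<dots> = (1 - ?X) * V"
      using quad unfolding T_eq g_def u_def
      by (simp add: algebra_simps power2_eq_square flip: fps_const_mult fps_const_add)
    finally show ?thesis by simp
  qed
  moreover have "1 - ?X \<noteq> 0"
    by (metis fps_X_neq_one right_minus_eq)
  ultimately have V_eq: "V = ?C z * ?X * (1 + ?C (1 + t) * V + ?C t * V * T)"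
    by (simp only: mult_cancel_left simp_thms)
  have V1_eq: "fps_nth V (Suc c) = z * (of_bool (c = 0) + (1 + t) * fps_nth V c
       + t * (\<Sum>a\<le>c. fps_nth V a * fps_nth T (c - a)))" for c
    by (subst V_eq) (simp add: mult.assoc fps_mult_nth[of V T] atLeast0AtMost)
  have "summable (fps_nth V)"
  proof (rule summable_comparison_test')
    show "summable (\<lambda>n. \<kappa> * \<alpha> ^ n)" using ord by (intro summable_mult summable_geometric) auto
    fix n
    show "norm (fps_nth V n) \<le> \<kappa> * \<alpha> ^ n"
    proof (cases n)
      case (Suc m)
      have "fps_nth V n \<le> \<kappa> * (\<alpha> * fps_nth M m)"
        unfolding Suc V_Suc using pos Mpos[of "Suc m"] by (intro mult_left_mono) auto
      also have "\<dots> \<le> \<kappa> * (\<alpha> * \<alpha> ^ m)" using pos ord M_le_power by (intro mult_left_mono) auto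
      finally show ?thesis using V_nonneg[of n] Suc by simp
    qed (use V0 pos in simp)
  qed
  then obtain S where S: "fps_nth V sums S" by (auto simp: summable_def)
  have S1: "fps_nth V 1 \<le> S"
    using sum_le_suminf[OF sums_summable[OF S], of "{1}"] V_nonneg sums_unique[OF S] by simp
  moreover have "fps_nth V 1 = z" using V1_eq[of 0] V0 by simp
  ultimately have "S > 0" using pos by simp
  have cmult: "fps_nth (?C c * F) sums (c * x)" if "fps_nth F sums x" for c x F
  proof -
    have "fps_nth (?C c * F) = (\<lambda>n. c * fps_nth F n)" by (simp add: fun_eq_iff)
    then show ?thesis using sums_mult[OF that, of c] by simp
  qed
  have XV: "fps_nth (?X * V) sums S" and XXV: "fps_nth (?X * (?X * V)) sums S"
    and XXVV: "fps_nth (?X * (?X * (V * V))) sums (S * S)"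
    using S V_nonneg by (auto intro!: fps_sums_X_mult fps_sums_mult)
  have one: "fps_nth (1 :: real fps) = (\<lambda>r. if r = 0 then 1 else 0)"
    by (simp add: fun_eq_iff)
  have X: "fps_nth ?X sums 1" "fps_nth (?X * ?X) sums 1"
    using fps_sums_X_mult[of 1 1] sums_single[of 0 "\<lambda>_. 1::real"] fps_sums_X_mult[of ?X 1]
    by (simp_all add: one)
  \<comment> \<open>At X = 1 everything cancels except z t S^2 - u S, which forces S = s because S >
    0.\<close>
  have "fps_nth (V - ?X * V - (?C z * ?X - ?C z * (?X * ?X)) - (?C g * (?X * V) - ?C g * (?X * (?X * V)))
      - ?C u * (?X * V) + ?C (z * t) * (?X * (?X * (V * V))))
    sums (S - S - (z * 1 - z * 1) - (g * S - g * S) - u * S + z * t * (S * S))"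
    unfolding fps_sub_nth fps_add_nth
    by (intro sums_add sums_diff cmult S XV XXV XXVV X)
  also have "V - ?X * V - (?C z * ?X - ?C z * (?X * ?X)) - (?C g * (?X * V) - ?C g * (?X * (?X * V)))
      - ?C u * (?X * V) + ?C (z * t) * (?X * (?X * (V * V))) = 0"
    using quad by (simp add: algebra_simps power2_eq_square del: fps_const_mult)
  finally have "z * t * (S * S) - u * S = 0"
    using sums_unique2[OF _ sums_zero] by fastforce
  then have "S * (z * t) * (S - s) = 0" by (simp add: u_def algebra_simps)
  then have "S = s" using \<open>S > 0\<close> pos by simp
  have T_nonneg: "fps_nth T i \<ge> 0" for i
  proof -
    have "(\<Sum>j<i. fps_nth V j) \<le> S"
      using sum_le_suminf[OF sums_summable[OF S], of "{..<i}"] V_nonneg sums_unique[OF S] by simp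
    then show ?thesis by (simp add: T_def \<open>S = s\<close>)
  qed
  show thesis
    by (rule that[of "fps_nth V" "fps_nth T"]) (use V_nonneg T_nonneg V0 V1_eq in \<open>simp_all add: T_def\<close>)
qed

section \<open>The growth rate\<close>

lemma omega_bounds:
  fixes \<omega> :: real
  assumes "4*\<omega>^3 - 3*\<omega>^2 + 4*\<omega> - 1 = 0"
  shows "0 < \<omega>" "\<omega> < 1/2"
proof -
  show "0 < \<omega>"
  proof (rule ccontr)
    assume "\<not> 0 < \<omega>"
    then have "\<omega>^3 \<le> 0" "\<omega> \<le> 0" by (simp_all add: power3_eq_cube mult_nonneg_nonpos)
    then show False using assms zero_le_power2[of \<omega>] by linarith
  qed
  show "\<omega> < 1/2"
  proof (rule ccontr)
    assume "\<not> \<omega> < 1/2"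
    then have "\<omega> \<ge> 1/2" by simp
    \<comment> \<open>Splitting off a square leaves a linear function that is already positive at
      1/2, since 55/32 > 1.\<close>
    moreover have "4*\<omega>^3 - 3*\<omega>^2 + 4*\<omega> - 1 = 4 * (\<omega> * (\<omega> - 3/8)^2) + 55/16 * \<omega> - 1"
      by (simp add: field_simps power2_eq_square power3_eq_cube)
    moreover have "\<omega> * (\<omega> - 3/8)^2 \<ge> 0" using \<open>\<omega> \<ge> 1/2\<close> by simp
    ultimately show False using assms by linarith
  qed
qed

text \<open>In the parametrization \<open>z t = p (1 - q)\<^sup>2\<close>, \<open>z = q (1 - p)\<^sup>2\<close> of Brown and Tutte, the generating
  function of 2-stack-sortable permutations by length and descents is singular where \<open>(1 - p) (1 - q) = 4 p q\<close>; below,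
  \<open>p = \<omega> / (2 - \<omega>)\<close> and \<open>q = (1 - \<omega>) / (1 + \<omega>)\<close>, so that \<open>\<omega> n\<close> is the dominant number of descents.\<close>
lemma critical_parameters:
  fixes \<omega> :: real
  assumes w: "0 < \<omega>" "\<omega> < 1/2"
  defines "D \<equiv> (1 + \<omega>) * (2 - \<omega>)"
  defines "\<alpha> \<equiv> 2 / D" and "b \<equiv> 2 * (1 - 2 * \<omega>)\<^sup>2 / D"
    and "z \<equiv> 4 * (1 - \<omega>) ^ 3 / ((1 + \<omega>) * (2 - \<omega>)\<^sup>2)"
    and "t \<equiv> \<omega> ^ 3 * (2 - \<omega>) / ((1 - \<omega>) ^ 3 * (1 + \<omega>))"
    and "\<kappa> \<equiv> (1 - \<omega>)\<^sup>2 / (\<omega> * (2 - \<omega>))"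
  shows "0 < b" "b < \<alpha>" "\<alpha> < 1" "z > 0" "t > 0" "\<kappa> > 0"
    and "((\<alpha> - b) / 4)\<^sup>2 = z * t * \<kappa>"
    and "\<alpha> + (\<alpha> + b) / 2 = 1 + z * (1 + t) + z * t * (3 / 4 * \<kappa>)"
    and "\<alpha> * ((\<alpha> + b) / 2) = z * (1 + t) + 2 * ((\<alpha> - b) / 4)\<^sup>2"
    and "2 * \<alpha> = 1 + z / \<kappa> + z * (1 + t) + z * t * (3 / 4 * \<kappa>)"
    and "\<alpha>\<^sup>2 = z / \<kappa> + z * (1 + t) + ((\<alpha> - b) / 4)\<^sup>2"
proof -
  have nz: "\<omega> \<noteq> 0" "1 - \<omega> \<noteq> 0" "1 + \<omega> \<noteq> 0" "2 - \<omega> \<noteq> 0" using w by auto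
  have D: "D > 2" "D \<noteq> 0"
  proof -
    have "D - 2 = \<omega> * (1 - \<omega>)" by (simp add: D_def algebra_simps)
    moreover have "\<omega> * (1 - \<omega>) > 0" using w by simp
    ultimately show "D > 2" "D \<noteq> 0" by linarith+
  qed
  show "\<alpha> < 1" using D by (simp add: \<alpha>_def)
  show "0 < b" using D w by (simp add: b_def)
  show "b < \<alpha>"
  proof -
    have "1 - (1 - 2 * \<omega>)\<^sup>2 = 4 * (\<omega> * (1 - \<omega>))" by (simp add: power2_eq_square algebra_simps)
    moreover have "\<omega> * (1 - \<omega>) > 0" using w by simp
    ultimately have "(1 - 2 * \<omega>)\<^sup>2 < 1" by linarith
    then show ?thesis using D by (simp add: b_def \<alpha>_def divide_strict_right_mono)
  qed
  show "z > 0" "t > 0" "\<kappa> > 0" using w by (simp_all add: z_def t_def \<kappa>_def)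
  \<comment> \<open>Over the common denominator D^2 each identity reduces to a polynomial identity
    in \<omega>.\<close>
  have z: "z = 4 * (1 - \<omega>) ^ 3 * (1 + \<omega>) / D\<^sup>2"
    using nz by (simp add: z_def D_def divide_simps) (simp add: power2_eq_square)
  have zt: "z * t = 4 * \<omega> ^ 3 * (2 - \<omega>) / D\<^sup>2"
    using nz by (simp add: z_def t_def D_def power_mult_distrib power2_eq_square)
  have ztk: "z * t * \<kappa> = 4 * \<omega>\<^sup>2 * (1 - \<omega>)\<^sup>2 / D\<^sup>2"
    unfolding zt using nz by (simp add: \<kappa>_def power2_eq_square power3_eq_cube)
  have zk: "z / \<kappa> = 4 * \<omega> * (1 - \<omega>) * D / D\<^sup>2"
    using nz by (simp add: z_def \<kappa>_def D_def power2_eq_square power3_eq_cube)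
  have \<alpha>: "\<alpha> = 2 * D / D\<^sup>2" and b: "b = 2 * (1 - 2 * \<omega>)\<^sup>2 * D / D\<^sup>2" and one: "1 = D\<^sup>2 / D\<^sup>2"
    using D by (simp_all add: \<alpha>_def b_def power2_eq_square)
  have \<gamma>: "((\<alpha> - b) / 4)\<^sup>2 = 4 * \<omega>\<^sup>2 * (1 - \<omega>)\<^sup>2 / D\<^sup>2"
  proof -
    have "(\<alpha> - b) / 4 = 2 * \<omega> * (1 - \<omega>) / D"
      using D by (simp add: \<alpha>_def b_def field_simps power2_eq_square)
    then show ?thesis by (simp add: power_mult_distrib power_divide)
  qed
  show "((\<alpha> - b) / 4)\<^sup>2 = z * t * \<kappa>" unfolding \<gamma> ztk ..
  have zz: "z * (1 + t) = z + z * t" by (simp add: algebra_simps)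
  \<comment> \<open>\<open>3 / 4 * \<kappa>\<close> is the value taken for \<open>s\<close> in
    \<open>critical_fixed_point\<close>.\<close>
  have zs: "z * t * (3 / 4 * \<kappa>) = 3 / 4 * (z * t * \<kappa>)" by simp
  have "\<alpha> + (\<alpha> + b) / 2 - 1 - z - z * t - 3 / 4 * (z * t * \<kappa>) = 0"
    unfolding ztk unfolding zt unfolding z \<alpha> b by (subst one) (simp add: divide_simps D, simp add: D_def algebra_simps power2_eq_square power3_eq_cube)
  then show "\<alpha> + (\<alpha> + b) / 2 = 1 + z * (1 + t) + z * t * (3 / 4 * \<kappa>)"
    unfolding zz zs by linarith
  have "2 * \<alpha> - 1 - z / \<kappa> - z - z * t - 3 / 4 * (z * t * \<kappa>) = 0"
    unfolding ztk zk unfolding zt unfolding z \<alpha> by (subst one) (simp add: divide_simps D, simp add: D_def algebra_simps power2_eq_square power3_eq_cube)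
  then show "2 * \<alpha> = 1 + z / \<kappa> + z * (1 + t) + z * t * (3 / 4 * \<kappa>)"
    unfolding zz zs by linarith
  have "\<alpha> * ((\<alpha> + b) / 2) = (2 + 2 * (1 - 2 * \<omega>)\<^sup>2) / D\<^sup>2"
    using D by (simp add: \<alpha>_def b_def field_simps power2_eq_square)
  then have "\<alpha> * ((\<alpha> + b) / 2) - z - z * t - 2 * ((\<alpha> - b) / 4)\<^sup>2 = 0"
    unfolding \<gamma> unfolding zt unfolding z by (simp add: divide_simps D) (simp add: algebra_simps power2_eq_square power3_eq_cube)
  then show "\<alpha> * ((\<alpha> + b) / 2) = z * (1 + t) + 2 * ((\<alpha> - b) / 4)\<^sup>2"
    unfolding zz by linarith
  have "\<alpha>\<^sup>2 = 4 / D\<^sup>2" by (simp add: \<alpha>_def power_divide)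
  then have "\<alpha>\<^sup>2 - z / \<kappa> - z - z * t - ((\<alpha> - b) / 4)\<^sup>2 = 0"
    unfolding \<gamma> zk unfolding zt unfolding z by (simp add: divide_simps D, simp add: D_def algebra_simps power2_eq_square power3_eq_cube)
  then show "\<alpha>\<^sup>2 = z / \<kappa> + z * (1 + t) + ((\<alpha> - b) / 4)\<^sup>2"
    unfolding zz by linarith
qed

text \<open>Expand the logarithm of the left side in \<omega>, keeping the inner logarithms as they
  are. The coefficient of \<omega> is the logarithm of the ratio of the two sides of
  \<open>eq\<close>, hence 0. It is also the derivative in \<omega>, so \<open>eq\<close> says that
  the entropy expression is stationary.\<close>

lemma entropy_form:
  fixes \<omega> :: real
  assumes w: "0 < \<omega>" "\<omega> < 1/2" and eq: "4 * \<omega> ^ 3 * (2 - \<omega>) = (1 - 2 * \<omega>)\<^sup>2 * (1 - \<omega>) * (1 + \<omega>)"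
  shows "((2-\<omega>) powr (2-\<omega>) * (1+\<omega>) powr (1+\<omega>)) /
    (\<omega> powr \<omega> * (1-\<omega>) powr (1-\<omega>) * (2*\<omega>) powr (2*\<omega>) * (1-2*\<omega>) powr (1-2*\<omega>))
    = (1 + \<omega>) * (2 - \<omega>)\<^sup>2 / ((1 - 2 * \<omega>) * (1 - \<omega>))" (is "?l = ?r")
proof -
  have pos: "\<omega> > 0" "2 - \<omega> > 0" "1 + \<omega> > 0" "1 - \<omega> > 0" "1 - 2 * \<omega> > 0" "2 * \<omega> > 0" using w by auto
  have "(2 * \<omega>)\<^sup>2 * \<omega> * (2 - \<omega>) = (1 - 2 * \<omega>)\<^sup>2 * (1 - \<omega>) * (1 + \<omega>)"
    using eq by (simp add: power2_eq_square power3_eq_cube)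
  then have "ln ((2 * \<omega>)\<^sup>2 * \<omega> * (2 - \<omega>)) = ln ((1 - 2 * \<omega>)\<^sup>2 * (1 - \<omega>) * (1 + \<omega>))" by simp
  then have rel: "2 * ln (2 * \<omega>) + ln \<omega> + ln (2 - \<omega>) = 2 * ln (1 - 2 * \<omega>) + ln (1 - \<omega>) + ln (1 + \<omega>)"
    using pos by (simp only: ln_mult_pos ln_realpow zero_less_power mult_pos_pos of_nat_numeral)
  have "ln ?l = (2-\<omega>) * ln (2-\<omega>) + (1+\<omega>) * ln (1+\<omega>) - (\<omega> * ln \<omega> + (1-\<omega>) * ln (1-\<omega>)
      + (2*\<omega>) * ln (2*\<omega>) + (1-2*\<omega>) * ln (1-2*\<omega>))"
    using pos by (simp only: ln_div ln_mult_pos ln_powr powr_gt_zero mult_pos_pos) simp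
  also have "\<dots> = ln (1 + \<omega>) + 2 * ln (2 - \<omega>) - ln (1 - 2 * \<omega>) - ln (1 - \<omega>)
      + \<omega> * ((2 * ln (1 - 2 * \<omega>) + ln (1 - \<omega>) + ln (1 + \<omega>)) - (2 * ln (2 * \<omega>) + ln \<omega> + ln (2 - \<omega>)))"
    by (simp only: algebra_simps)
  also have "\<dots> = ln (1 + \<omega>) + 2 * ln (2 - \<omega>) - ln (1 - 2 * \<omega>) - ln (1 - \<omega>)"
    unfolding rel by simp
  also have "\<dots> = ln ?r"
    using pos by (simp only: ln_div ln_mult_pos ln_realpow zero_less_power mult_pos_pos) simp
  finally have "ln ?l = ln ?r" .
  moreover have "?l > 0" "?r > 0" using pos by simp_all
  ultimately show ?thesis by (simp only: ln_inj_iff)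
qed

theorem theorem4p2:
  fixes \<omega> :: real
  assumes "\<exists>!x::real. 4*x^3 - 3*x^2 + 4*x - 1 = 0"
    and "4*\<omega>^3 - 3*\<omega>^2 + 4*\<omega> - 1 = 0"
    and "convergent (\<lambda>n. root n (real (W3 n)))"
  shows "lim (\<lambda>n. root n (real (W3 n))) \<le>
    ((2-\<omega>) powr (2-\<omega>) * (1+\<omega>) powr (1+\<omega>)) /
    (\<omega> powr \<omega> * (1-\<omega>) powr (1-\<omega>) * (2*\<omega>) powr (2*\<omega>) * (1-2*\<omega>) powr (1-2*\<omega>))"
proof -
  note w = omega_bounds[OF assms(2)]
  define z where "z = 4 * (1 - \<omega>) ^ 3 / ((1 + \<omega>) * (2 - \<omega>)\<^sup>2)"
  define t where "t = \<omega> ^ 3 * (2 - \<omega>) / ((1 - \<omega>) ^ 3 * (1 + \<omega>))"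
  define y where "y = 1 - 2 * \<omega>"
  define K where "K = (1 + y)\<^sup>2 / y"
  have y: "y > 0" using w by (simp add: y_def)
  have zt: "z > 0" "t > 0" using critical_parameters(4,5)[OF w] by (simp_all add: z_def t_def)
  have eq: "4 * \<omega> ^ 3 * (2 - \<omega>) = (1 - 2 * \<omega>)\<^sup>2 * (1 - \<omega>) * (1 + \<omega>)"
  proof -
    have "4 * \<omega> ^ 3 * (2 - \<omega>) - (1 - 2 * \<omega>)\<^sup>2 * (1 - \<omega>) * (1 + \<omega>) = 4*\<omega>^3 - 3*\<omega>^2 + 4*\<omega> - 1"
      by (simp add: algebra_simps power2_eq_square power3_eq_cube)
    then show ?thesis using assms(2) by simp
  qed
  have K: "K = 4 * (1 - \<omega>)\<^sup>2 / (1 - 2 * \<omega>)"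
    by (simp add: K_def y_def power2_eq_square algebra_simps)
  have Kt: "K * t = y"
  proof -
    have "K * t = (4 * \<omega> ^ 3 * (2 - \<omega>)) / ((1 - 2 * \<omega>) * (1 - \<omega>) * (1 + \<omega>))"
    proof -
      have "4 * p\<^sup>2 / q * (\<omega> ^ 3 * r / (p ^ 3 * s)) = 4 * \<omega> ^ 3 * r / (q * p * s)" if "p \<noteq> 0" for p q r s :: real
        using that by (simp add: power2_eq_square power3_eq_cube)
      then show ?thesis unfolding K t_def using w by simp
    qed
    also have "\<dots> = y"
      unfolding eq using w by (simp add: y_def power2_eq_square)
    finally show ?thesis .
  qed
  have bound: "((2-\<omega>) powr (2-\<omega>) * (1+\<omega>) powr (1+\<omega>)) /
    (\<omega> powr \<omega> * (1-\<omega>) powr (1-\<omega>) * (2*\<omega>) powr (2*\<omega>) * (1-2*\<omega>) powr (1-2*\<omega>)) = K / z"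
    unfolding entropy_form[OF w eq] using w
    by (simp add: K z_def power2_eq_square power3_eq_cube)
  obtain v \<tau> :: "nat \<Rightarrow> real" where
    fp: "\<And>c. v c \<ge> 0" "\<And>i. \<tau> i \<ge> 0" "\<And>i. \<tau> (Suc i) = \<tau> i - v i"
    "\<And>c. v (Suc c) = z * (of_bool (c = 0) + (1 + t) * v c + t * (\<Sum>a\<le>c. v a * \<tau> (c - a)))"
    using critical_fixed_point[OF critical_parameters[OF w]] unfolding z_def t_def by blast
  \<comment> \<open>The summand 1 makes \<open>C\<close> positive, so that its n-th root tends to
    1.\<close>
  define C where "C = t * \<tau> 0 / y + 1"
  have C: "C > 0" using fp(2)[of 0] zt y by (simp add: C_def add_nonneg_pos)
  have K0: "K > 0" using y by (simp add: K_def)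
  have W3: "real (W3 n) \<le> C * (K / z) ^ n" if "n > 0" for n
  proof -
    let ?s = "\<Sum>T\<in>{T\<in>trees n. tsize T = n}. t ^ tdes T"
    have "z ^ n * ?s \<le> \<tau> 0"
      by (rule trees_size_sum_le[OF less_imp_le[OF zt(1)] less_imp_le[OF zt(2)] fp that])
    then have "?s \<le> \<tau> 0 / z ^ n" using zt by (simp add: field_simps)
    then have "t * K ^ n * ?s \<le> t * K ^ n * (\<tau> 0 / z ^ n)"
      using zt K0 by (intro mult_left_mono) auto
    then have "y * W3 n \<le> t * K ^ n * (\<tau> 0 / z ^ n)"
      using W3_le_tree_sum[OF y K_def Kt that] by linarith
    then have "W3 n \<le> t * K ^ n * (\<tau> 0 / z ^ n) / y"
      by (metis mult.commute pos_le_divide_eq y)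
    also have "\<dots> = t * \<tau> 0 / y * (K / z) ^ n" by (simp add: power_divide mult_ac)
    also have "\<dots> \<le> C * (K / z) ^ n" using K0 zt by (intro mult_right_mono) (auto simp: C_def)
    finally show ?thesis .
  qed
  have "(\<lambda>n. root n C * (K / z)) \<longlonglongrightarrow> 1 * (K / z)"
    by (intro tendsto_mult tendsto_const LIMSEQ_root_const C)
  moreover have "(\<lambda>n. root n (real (W3 n))) \<longlonglongrightarrow> lim (\<lambda>n. root n (real (W3 n)))"
    using assms(3) by (simp add: convergent_LIMSEQ_iff)
  moreover have "\<forall>n\<ge>1. root n (real (W3 n)) \<le> root n C * (K / z)"
  proof (intro allI impI)
    fix n :: nat assume n: "n \<ge> 1"
    have "root n (real (W3 n)) \<le> root n (C * (K / z) ^ n)"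
      using W3[of n] n by simp
    also have "\<dots> = root n C * (K / z)"
      using n K0 zt by (simp add: real_root_mult real_root_power_cancel)
    finally show "root n (real (W3 n)) \<le> root n C * (K / z)" .
  qed
  ultimately have "lim (\<lambda>n. root n (real (W3 n))) \<le> 1 * (K / z)"
    by (intro LIMSEQ_le[where X = "\<lambda>n. root n (real (W3 n))"]) blast+
  then show ?thesis unfolding bound by simp
qed

end
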